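(* Let $\mathsf{E}(\mathcal{D}_n):=|\{(d_1,d_2,d_3,d_4)\in\mathcal{D}_n^4:\ d_1+d_2=d_3+d_4\}|$. (a) For every squarefree integer $n\ge1$, $\mathsf{E}(\mathcal{D}_n)\ll (7.8784716)^{\omega(n)}$. (b) For every integer $n\ge2$, $\mathsf{E}(\mathcal{D}_n)\ll \dfrac{\tau(n)^3}{\sqrt{\Omega_2(n)}}$. The implied constants are absolute.
   Context: $\mathcal{D}_n$ is the set of positive divisors of $n$, $\tau(n)=|\mathcal{D}_n|$, $\omega(n)$ is the number of distinct prime factors of $n$, and $\Omega_2(n):=\sum_{p^v\| n}v^2$. *)

theory Defs
  imports Complex_Main "HOL-Computational_Algebra.Computational_Algebra"
begin

definition divisors :: "nat \<Rightarrow> nat set" where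
  "divisors n = {d. d dvd n}"

definition tau :: "nat \<Rightarrow> nat" where
  "tau n = card (divisors n)"

definition omega :: "nat \<Rightarrow> nat" where
  "omega n = card (prime_factors n)"

definition Omega2 :: "nat \<Rightarrow> nat" where
  "Omega2 n = (\<Sum>p\<in>prime_factors n. (multiplicity p n)\<^sup>2)"

definition additive_energy :: "nat set \<Rightarrow> nat" where
  "additive_energy A =
     card {(d1, d2, d3, d4). d1 \<in> A \<and> d2 \<in> A \<and> d3 \<in> A \<and> d4 \<in> A \<and> d1 + d2 = d3 + d4}"

end

theory Submission
  imports Defs "HOL-Analysis.Convex"
begin

text \<open>
  A nonnegative function on the solution set with total mass at most 1 and minimum at least b shows that
  there are at most 1/b solutions, and such functions are closed under weighted geometric means.
  Record a solution of d1 + d2 = d3 + d4 by its exponents at each prime p dividing n; the minimum of the four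
  exponents is attained at least twice. There are two sources of weights that are products over the primes:
  three of the d's determine the fourth, so any probability distribution on the triples of exponents will do; and
  the ratios d1/d2 and d3/d4 determine the solution up to scaling, and a scaling can change exponents at a
  prime dividing n exactly once only between (0,0,0,0) and (1,1,1,1).

  For squarefree n, four weights of the first kind and one of the second, with numerically optimised local
  distributions, give (a). For (b), fix the pair of positions at which the minimum is attained at the prime p
  of largest exponent k: this alone saves a factor k + 1 over the trivial bound, and each further prime of exponent at
  least 2 saves a constant factor, as no distribution on patterns has all its triple marginals uniform. Another
  bound, saving a constant factor for each prime of exponent 1, combines this with the weight for (a).
\<close>

subsection \<open>Subprobability weights\<close>

text \<open>The local patterns determine an element of \<open>S\<close>, so \<open>S\<close> embeds
  into the product of the sets \<open>A p\<close>, over which the sum of products factors into the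
  local sums.\<close>

lemma sum_prod_weight_le_1:
  fixes w :: "'p \<Rightarrow> 'x \<Rightarrow> real"
  assumes "finite P" and "\<And>p. p \<in> P \<Longrightarrow> finite (A p)"
    and f: "\<And>s p. s \<in> S \<Longrightarrow> p \<in> P \<Longrightarrow> f s p \<in> A p"
    and inj: "\<And>s t. s \<in> S \<Longrightarrow> t \<in> S \<Longrightarrow> (\<And>p. p \<in> P \<Longrightarrow> f s p = f t p) \<Longrightarrow> s = t"
    and nonneg: "\<And>p x. p \<in> P \<Longrightarrow> x \<in> A p \<Longrightarrow> 0 \<le> w p x"
    and le_1: "\<And>p. p \<in> P \<Longrightarrow> (\<Sum>x\<in>A p. w p x) \<le> 1"
  shows "(\<Sum>s\<in>S. \<Prod>p\<in>P. w p (f s p)) \<le> 1"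
proof -
  let ?g = "\<lambda>s. restrict (f s) P"
  have inj_g: "inj_on ?g S"
  proof (rule inj_onI)
    fix s t assume st: "s \<in> S" "t \<in> S" "?g s = ?g t"
    have "f s p = f t p" if "p \<in> P" for p
      using fun_cong[OF st(3), of p] that by simp
    then show "s = t" using inj st by blast
  qed
  have sub: "?g ` S \<subseteq> PiE P A" using f by auto
  have "(\<Sum>s\<in>S. \<Prod>p\<in>P. w p (f s p)) = (\<Sum>h\<in>?g ` S. \<Prod>p\<in>P. w p (h p))"
    by (subst sum.reindex[OF inj_g]) simp
  also have "\<dots> \<le> (\<Sum>h\<in>PiE P A. \<Prod>p\<in>P. w p (h p))"
    using assms(1,2) by (intro sum_mono2 sub finite_PiE prod_nonneg) (auto intro!: nonneg)
  also have "\<dots> = (\<Prod>p\<in>P. \<Sum>x\<in>A p. w p x)"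
    by (rule prod_sum_PiE[symmetric]) (use assms in auto)
  also have "\<dots> \<le> 1"
    by (intro prod_le_1) (auto intro!: sum_nonneg nonneg le_1)
  finally show ?thesis .
qed

text \<open>Two-stage version: each class of elements with equal keys is bounded by
  \<open>sum_prod_weight_le_1\<close>, then the keys are summed. In \<open>v_le_1\<close> the key is
  held fixed on all of \<open>P\<close>, since what restricts the pattern at \<open>p\<close> may
  come from the other primes.\<close>

lemma sum_prod_key_weight_le_1:
  fixes w :: "'p \<Rightarrow> 'y \<Rightarrow> real" and v :: "'p \<Rightarrow> 'x \<Rightarrow> real"
  assumes "finite P" "finite S" and "\<And>p. p \<in> P \<Longrightarrow> finite (K p)"
    and key: "\<And>s p. s \<in> S \<Longrightarrow> p \<in> P \<Longrightarrow> key s p \<in> K p"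
    and inj: "\<And>s t. s \<in> S \<Longrightarrow> t \<in> S \<Longrightarrow> (\<And>p. p \<in> P \<Longrightarrow> f s p = f t p) \<Longrightarrow> s = t"
    and w_nonneg: "\<And>p y. p \<in> P \<Longrightarrow> y \<in> K p \<Longrightarrow> 0 \<le> w p y"
    and w_le_1: "\<And>p. p \<in> P \<Longrightarrow> (\<Sum>y\<in>K p. w p y) \<le> 1"
    and v_nonneg: "\<And>p x. p \<in> P \<Longrightarrow> 0 \<le> v p x"
    and v_le_1: "\<And>s p. s \<in> S \<Longrightarrow> p \<in> P \<Longrightarrow>
      (\<Sum>x\<in>(\<lambda>t. f t p) ` {t\<in>S. \<forall>q\<in>P. key t q = key s q}. v p x) \<le> 1"
  shows "(\<Sum>s\<in>S. \<Prod>p\<in>P. w p (key s p) * v p (f s p)) \<le> 1"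
proof -
  let ?g = "\<lambda>s. restrict (key s) P"
  have sub: "?g ` S \<subseteq> PiE P K" using key by auto
  have fibre: "(\<Sum>s\<in>{s\<in>S. ?g s = h}. \<Prod>p\<in>P. v p (f s p)) \<le> 1" if h: "h \<in> ?g ` S" for h
  proof -
    obtain t where t: "t \<in> S" "h = ?g t" using h by blast
    have eq: "{s\<in>S. ?g s = h} = {s\<in>S. \<forall>q\<in>P. key s q = key t q}"
      unfolding t by (auto simp: restrict_def fun_eq_iff)
    show ?thesis unfolding eq
      by (rule sum_prod_weight_le_1[where A="\<lambda>p. (\<lambda>s. f s p) ` {s\<in>S. \<forall>q\<in>P. key s q = key t q}"])
         (use assms(1,2) t(1) v_nonneg v_le_1 inj in auto)
  qed
  have "(\<Sum>s\<in>S. \<Prod>p\<in>P. w p (key s p) * v p (f s p))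
      = (\<Sum>h\<in>?g ` S. \<Sum>s\<in>{s\<in>S. ?g s = h}. \<Prod>p\<in>P. w p (key s p) * v p (f s p))"
    by (rule sum.image_gen[OF assms(2)])
  also have "\<dots> = (\<Sum>h\<in>?g ` S. (\<Prod>p\<in>P. w p (h p)) * (\<Sum>s\<in>{s\<in>S. ?g s = h}. \<Prod>p\<in>P. v p (f s p)))"
    unfolding sum_distrib_left prod.distrib by (intro sum.cong refl) auto
  also have "\<dots> \<le> (\<Sum>h\<in>?g ` S. \<Prod>p\<in>P. w p (h p))"
    by (intro sum_mono mult_left_le fibre prod_nonneg) (auto intro!: w_nonneg key)
  also have "\<dots> \<le> (\<Sum>h\<in>PiE P K. \<Prod>p\<in>P. w p (h p))"
    using assms(1,3) by (intro sum_mono2 sub finite_PiE prod_nonneg) (auto intro!: w_nonneg)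
  also have "\<dots> = (\<Prod>p\<in>P. \<Sum>y\<in>K p. w p y)"
    by (rule prod_sum_PiE[symmetric]) (use assms in auto)
  also have "\<dots> \<le> 1"
    by (intro prod_le_1) (auto intro!: sum_nonneg w_nonneg w_le_1)
  finally show ?thesis .
qed

text \<open>Weighted AM-GM at each point.\<close>

lemma sum_powr_mean_le_1:
  fixes f g :: "'s \<Rightarrow> real"
  assumes "\<And>s. s \<in> S \<Longrightarrow> 0 \<le> f s" "\<And>s. s \<in> S \<Longrightarrow> 0 \<le> g s"
    and "sum f S \<le> 1" "sum g S \<le> 1" and t: "0 < t" "t < 1"
  shows "(\<Sum>s\<in>S. f s powr (1 - t) * g s powr t) \<le> 1"
proof -
  have "(\<Sum>s\<in>S. f s powr (1 - t) * g s powr t) \<le> (\<Sum>s\<in>S. (1 - t) * f s + t * g s)"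
  proof (rule sum_mono)
    fix s assume "s \<in> S"
    then show "f s powr (1 - t) * g s powr t \<le> (1 - t) * f s + t * g s"
      using Youngs_inequality_0[of "1 - t" t "f s" "g s"] assms(1,2)[of s] t
      \<comment> \<open>Young's inequality wants positive numbers; at a zero the left side is
        0.\<close>
      by (cases "f s = 0 \<or> g s = 0") auto
  qed
  also have "\<dots> = (1 - t) * sum f S + t * sum g S"
    by (simp add: sum.distrib sum_distrib_left)
  also have "\<dots> \<le> (1 - t) * 1 + t * 1"
    using assms by (intro add_mono mult_left_mono) auto
  finally show ?thesis by simp
qed

lemma card_le_of_weight:
  fixes W :: "'s \<Rightarrow> real"
  assumes "sum W S \<le> 1" "\<And>s. s \<in> S \<Longrightarrow> b \<le> W s" "0 < b"
  shows "real (card S) \<le> 1 / b"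
proof -
  have "real (card S) * b \<le> sum W S"
    using sum_mono[of S "\<lambda>_. b" W] assms(2) by simp
  then show ?thesis using assms(1,3) by (simp add: field_simps)
qed

subsection \<open>Local weights\<close>

text \<open>The saving at a prime of exponent at least 2: small enough for
  \<open>sum_pair_weight_le\<close>, large enough for its 199th power to exceed 6.\<close>

definition gain :: real where "gain = 101 / 100"

text \<open>
  If the marginals on coordinates 1, 2, 3 and 1, 2, 4 of a distribution on tied patterns were both uniform,
  then a unique minimum at coordinate 1 or 2 would be too rare: it must be repeated in the fourth
  coordinate. Hence such triples can be given less weight, and those where the third coordinate repeats
  a strict minimum more, with a gain in the geometric mean of the two weights.
\<close>
definition pair_weight :: "nat \<times> nat \<times> nat \<Rightarrow> real" where
  "pair_weight = (\<lambda>(x, y, z). if x < y \<and> x < z \<or> y < x \<and> y < z then 4 / 5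
     else if x = z \<and> z < y \<or> y = z \<and> z < x then 5 / 4 * gain\<^sup>2 else gain)"

lemma pair_weight_pos: "0 < pair_weight v"
  by (auto simp: pair_weight_def gain_def split: prod.splits)

text \<open>One disjunct for each pair of positions that can share the minimum, so that
  \<open>elim disjE\<close> gives the six cases.\<close>

definition min_tied :: "nat \<Rightarrow> nat \<Rightarrow> nat \<Rightarrow> nat \<Rightarrow> bool" where
  "min_tied a b c d \<longleftrightarrow>
     a = b \<and> a \<le> c \<and> a \<le> d \<or> a = c \<and> a \<le> b \<and> a \<le> d \<or> a = d \<and> a \<le> b \<and> a \<le> c \<or>
     b = c \<and> b \<le> a \<and> b \<le> d \<or> b = d \<and> b \<le> a \<and> b \<le> c \<or> c = d \<and> c \<le> a \<and> c \<le> b"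

text \<open>If the first factor is 4/5, then a or b lies strictly below the other and c, so the tie
  puts the minimum at d as well and the second factor is 5/4 \<open>gain\<close>^2; likewise with c
  and d exchanged. In all other cases both factors are at least \<open>gain\<close>.\<close>

lemma pair_weight_mult_ge:
  assumes "min_tied a b c d"
  shows "gain\<^sup>2 \<le> pair_weight (a, b, c) * pair_weight (a, b, d)"
  using assms unfolding min_tied_def
  by (elim disjE) (auto simp: pair_weight_def gain_def power2_eq_square)

lemma sum_less_of_bool: 
  assumes "x \<le> k"
  shows "(\<Sum>y\<le>k. of_bool (x < y)) = real (k - x)"
proof -
  have "(\<Sum>y\<le>k. of_bool (x < y)) = (\<Sum>y\<in>{x<..k}. (1::real))"
    by (rule sum.mono_neutral_cong_right) auto
  then show ?thesis by simp
qed

lemma sum_squares_rev: "(\<Sum>x\<le>k. (real (k - x))\<^sup>2) = real k * (real k + 1) * (2 * real k + 1) / 6"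
proof -
  have "(\<Sum>x\<le>k. (real (k - x))\<^sup>2) = (\<Sum>x\<le>k. (real x)\<^sup>2)"
    by (rule sum.reindex_bij_witness[of _ "\<lambda>x. k - x" "\<lambda>x. k - x"]) auto
  also have "\<dots> = real k * (real k + 1) * (2 * real k + 1) / 6"
    by (induction k) (auto simp: field_simps power2_eq_square)
  finally show ?thesis .
qed

lemma sum_diff_rev: "(\<Sum>x\<le>k. real (k - x)) = real k * (real k + 1) / 2"
proof -
  have "(\<Sum>x\<le>k. real (k - x)) = (\<Sum>x\<le>k. real x)"
    by (rule sum.reindex_bij_witness[of _ "\<lambda>x. k - x" "\<lambda>x. k - x"]) auto
  also have "\<dots> = real k * (real k + 1) / 2"
    by (induction k) (auto simp: field_simps)
  finally show ?thesis .
qed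

text \<open>The reduced weight falls on about 2/3 of all triples, the increased one on only about
  k^2 of them. At k = 1 no saving is possible: the uniform distribution on binary patterns of even
  parity, which are all tied, has uniform marginals on every triple.\<close>

lemma sum_pair_weight_le:
  assumes "2 \<le> k"
  shows "(\<Sum>v\<in>{..k} \<times> {..k} \<times> {..k}. pair_weight v) \<le> (real k + 1) ^ 3"
proof -
  define U where "U = real k * (real k + 1) * (2 * real k + 1) / 6"
  define V where "V = real k * (real k + 1) / 2"
  \<comment> \<open>Deviations of the two exceptional values from \<open>gain\<close>;
    \<open>c\<close> is negative. \<open>U\<close> counts the triples with a strict minimum at the
    first coordinate, \<open>V\<close> those where it is shared with the third only.\<close>
  define c d where "c = 4 / 5 - gain" and "d = 5 / 4 * gain\<^sup>2 - gain"
  have U1: "(\<Sum>x\<le>k. \<Sum>y\<le>k. \<Sum>z\<le>k. of_bool (x < y) * of_bool (x < z)) = U"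
    using sum_squares_rev[of k]
    by (simp add: sum_less_of_bool U_def power2_eq_square del: sum_of_bool_eq
        flip: sum_distrib_left sum_distrib_right)
  have U2: "(\<Sum>x\<le>k. \<Sum>y\<le>k. \<Sum>z\<le>k. of_bool (y < x) * of_bool (y < z)) = U"
    by (subst sum.swap) (rule U1)
  have one: "(\<Sum>z\<le>k. of_bool (y = z)) = (1::real)" if "y \<le> k" for y
    using that by (simp add: of_bool_def if_distrib cong: if_cong)
  have "(\<Sum>x\<le>k. \<Sum>y\<le>k. \<Sum>z\<le>k. of_bool (y = z) * of_bool (y < x))
      = (\<Sum>x\<le>k. \<Sum>y\<le>k. of_bool (y < x) :: real)"
    by (simp add: one del: sum_of_bool_eq flip: sum_distrib_right)
  also have "\<dots> = (\<Sum>y\<le>k. \<Sum>x\<le>k. of_bool (y < x))"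
    by (rule sum.swap)
  also have "\<dots> = V"
    using sum_diff_rev[of k] by (simp add: sum_less_of_bool V_def del: sum_of_bool_eq)
  finally have V2: "(\<Sum>x\<le>k. \<Sum>y\<le>k. \<Sum>z\<le>k. of_bool (y = z) * of_bool (y < x)) = V" .
  have V1: "(\<Sum>x\<le>k. \<Sum>y\<le>k. \<Sum>z\<le>k. of_bool (x = z) * of_bool (x < y)) = V"
    by (subst sum.swap) (rule V2)
  have eq: "pair_weight (x, y, z) = gain + c * (of_bool (x < y) * of_bool (x < z))
       + c * (of_bool (y < x) * of_bool (y < z)) + d * (of_bool (x = z) * of_bool (x < y))
       + d * (of_bool (y = z) * of_bool (y < x))" for x y z
    by (auto simp: pair_weight_def c_def d_def)
  have "(\<Sum>v\<in>{..k} \<times> {..k} \<times> {..k}. pair_weight v) = (\<Sum>x\<le>k. \<Sum>y\<le>k. \<Sum>z\<le>k. pair_weight (x, y, z))"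
    by (simp add: sum.cartesian_product)
  also have "\<dots> = gain * (real k + 1) ^ 3 + c * U + c * U + d * V + d * V"
    unfolding eq sum.distrib
      U1[THEN arg_cong, of "(*) c", unfolded sum_distrib_left]
      U2[THEN arg_cong, of "(*) c", unfolded sum_distrib_left]
      V1[THEN arg_cong, of "(*) d", unfolded sum_distrib_left]
      V2[THEN arg_cong, of "(*) d", unfolded sum_distrib_left]
    by (simp add: power3_eq_cube algebra_simps)
  also have "\<dots> \<le> (real k + 1) ^ 3"
  proof -
    have "2 * (-c) * U - 2 * d * V - (gain - 1) * (real k + 1) ^ 3
      = (real k + 1) * (21/300 * (real k * (2 * real k + 1)) - 2 * d * real k / 2 - (real k + 1)\<^sup>2 / 100)"
      by (simp add: U_def V_def c_def gain_def power3_eq_cube power2_eq_square field_simps)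
    \<comment> \<open>After division by k + 1 a quadratic in k remains, for which k^2 \<ge> 2k
      suffices.\<close>
    moreover have "0 \<le> 21/300 * (real k * (2 * real k + 1)) - 2 * d * real k / 2 - (real k + 1)\<^sup>2 / 100"
    proof -
      have "2 * real k \<le> real k * real k" using assms by (intro mult_right_mono) auto
      moreover have "d \<le> 2652 / 10000" by (simp add: d_def gain_def power2_eq_square)
      then have "d * real k \<le> 2652 / 10000 * real k" by (intro mult_right_mono) auto
      moreover have "21/300 * (real k * (2 * real k + 1)) - 2 * d * real k / 2 - (real k + 1)\<^sup>2 / 100
        = 13/100 * (real k * real k) + 5/100 * real k - d * real k - 1/100"
        by (simp add: power2_eq_square field_simps)
      moreover have "2 \<le> real k" using assms by simp
      ultimately show ?thesis by linarith
    qed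
    ultimately have "0 \<le> 2 * (-c) * U - 2 * d * V - (gain - 1) * (real k + 1) ^ 3"
      by simp
    then show ?thesis by (simp add: algebra_simps)
  qed
  finally show ?thesis .
qed

subsection \<open>Families of patterns with tied minimum\<close>

text \<open>Abstracts the exponents \<open>x1\<close>, ..., \<open>x4\<close> of a solution
  \<open>s\<close> at the primes of n, \<open>k p\<close> being the exponent in n. Any three
  coordinates determine \<open>s\<close>. Unlike the equation d1 + d2 = d3 + d4, these axioms are
  symmetric in all four coordinates.\<close>

locale tied_family =
  fixes S :: "'s set" and P :: "'p set" and k :: "'p \<Rightarrow> nat"
    and x1 x2 x3 x4 :: "'s \<Rightarrow> 'p \<Rightarrow> nat"
  assumes finite_S: "finite S" and finite_P: "finite P"
    and bounds: "\<And>s p. s \<in> S \<Longrightarrow> p \<in> P \<Longrightarrow> x1 s p \<le> k p \<and> x2 s p \<le> k p \<and> x3 s p \<le> k p \<and> x4 s p \<le> k p"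
    and k_pos: "\<And>p. p \<in> P \<Longrightarrow> 1 \<le> k p"
    and tied: "\<And>s p. s \<in> S \<Longrightarrow> p \<in> P \<Longrightarrow> min_tied (x1 s p) (x2 s p) (x3 s p) (x4 s p)"
    and inj1: "\<And>s t. s \<in> S \<Longrightarrow> t \<in> S \<Longrightarrow>
      (\<And>p. p \<in> P \<Longrightarrow> x2 s p = x2 t p \<and> x3 s p = x3 t p \<and> x4 s p = x4 t p) \<Longrightarrow> s = t"
    and inj2: "\<And>s t. s \<in> S \<Longrightarrow> t \<in> S \<Longrightarrow>
      (\<And>p. p \<in> P \<Longrightarrow> x1 s p = x1 t p \<and> x3 s p = x3 t p \<and> x4 s p = x4 t p) \<Longrightarrow> s = t"
    and inj3: "\<And>s t. s \<in> S \<Longrightarrow> t \<in> S \<Longrightarrow>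
      (\<And>p. p \<in> P \<Longrightarrow> x1 s p = x1 t p \<and> x2 s p = x2 t p \<and> x4 s p = x4 t p) \<Longrightarrow> s = t"
    and inj4: "\<And>s t. s \<in> S \<Longrightarrow> t \<in> S \<Longrightarrow>
      (\<And>p. p \<in> P \<Longrightarrow> x1 s p = x1 t p \<and> x2 s p = x2 t p \<and> x3 s p = x3 t p) \<Longrightarrow> s = t"
begin

lemma subset:
  assumes "S' \<subseteq> S"
  shows "tied_family S' P k x1 x2 x3 x4"
proof unfold_locales
  show "finite S'" "finite P" using finite_S finite_P assms by (auto intro: finite_subset)
  show "1 \<le> k p" if "p \<in> P" for p using that by (rule k_pos)
next
  fix s p assume "s \<in> S'" "p \<in> P"
  then have sp: "s \<in> S" "p \<in> P" using assms by auto
  show "x1 s p \<le> k p \<and> x2 s p \<le> k p \<and> x3 s p \<le> k p \<and> x4 s p \<le> k p"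
    by (rule bounds[OF sp])
  show "min_tied (x1 s p) (x2 s p) (x3 s p) (x4 s p)"
    by (rule tied[OF sp])
next
  fix s t assume "s \<in> S'" "t \<in> S'"
  then have st: "s \<in> S" "t \<in> S" using assms by auto
  show "s = t" if "\<And>p. p \<in> P \<Longrightarrow> x2 s p = x2 t p \<and> x3 s p = x3 t p \<and> x4 s p = x4 t p"
    by (rule inj1[OF st that])
  show "s = t" if "\<And>p. p \<in> P \<Longrightarrow> x1 s p = x1 t p \<and> x3 s p = x3 t p \<and> x4 s p = x4 t p"
    by (rule inj2[OF st that])
  show "s = t" if "\<And>p. p \<in> P \<Longrightarrow> x1 s p = x1 t p \<and> x2 s p = x2 t p \<and> x4 s p = x4 t p"
    by (rule inj3[OF st that])
  show "s = t" if "\<And>p. p \<in> P \<Longrightarrow> x1 s p = x1 t p \<and> x2 s p = x2 t p \<and> x3 s p = x3 t p"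
    by (rule inj4[OF st that])
qed

text \<open>This and the next two lemmas are the adjacent transpositions, which generate all
  permutations of the coordinates.\<close>

lemma swap12: "tied_family S P k x2 x1 x3 x4"
proof unfold_locales
  show "finite S" "finite P" by (fact finite_S finite_P)+
  show "1 \<le> k p" if "p \<in> P" for p using that by (rule k_pos)
next
  fix s p assume "s \<in> S" "p \<in> P"
  then show "x2 s p \<le> k p \<and> x1 s p \<le> k p \<and> x3 s p \<le> k p \<and> x4 s p \<le> k p"
    using bounds by blast
  show "min_tied (x2 s p) (x1 s p) (x3 s p) (x4 s p)"
    using tied[OF \<open>s \<in> S\<close> \<open>p \<in> P\<close>] unfolding min_tied_def by (elim disjE) auto
next
  fix s t assume st: "s \<in> S" "t \<in> S"
  show "s = t" if "\<And>p. p \<in> P \<Longrightarrow> x1 s p = x1 t p \<and> x3 s p = x3 t p \<and> x4 s p = x4 t p"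
    by (rule inj2[OF st]) (use that in blast)
  show "s = t" if "\<And>p. p \<in> P \<Longrightarrow> x2 s p = x2 t p \<and> x3 s p = x3 t p \<and> x4 s p = x4 t p"
    by (rule inj1[OF st]) (use that in blast)
  show "s = t" if "\<And>p. p \<in> P \<Longrightarrow> x2 s p = x2 t p \<and> x1 s p = x1 t p \<and> x4 s p = x4 t p"
    by (rule inj3[OF st]) (use that in blast)
  show "s = t" if "\<And>p. p \<in> P \<Longrightarrow> x2 s p = x2 t p \<and> x1 s p = x1 t p \<and> x3 s p = x3 t p"
    by (rule inj4[OF st]) (use that in blast)
qed

lemma swap23: "tied_family S P k x1 x3 x2 x4"
proof unfold_locales
  show "finite S" "finite P" by (fact finite_S finite_P)+
  show "1 \<le> k p" if "p \<in> P" for p using that by (rule k_pos)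
next
  fix s p assume "s \<in> S" "p \<in> P"
  then show "x1 s p \<le> k p \<and> x3 s p \<le> k p \<and> x2 s p \<le> k p \<and> x4 s p \<le> k p"
    using bounds by blast
  show "min_tied (x1 s p) (x3 s p) (x2 s p) (x4 s p)"
    using tied[OF \<open>s \<in> S\<close> \<open>p \<in> P\<close>] unfolding min_tied_def by (elim disjE) auto
next
  fix s t assume st: "s \<in> S" "t \<in> S"
  show "s = t" if "\<And>p. p \<in> P \<Longrightarrow> x3 s p = x3 t p \<and> x2 s p = x2 t p \<and> x4 s p = x4 t p"
    by (rule inj1[OF st]) (use that in blast)
  show "s = t" if "\<And>p. p \<in> P \<Longrightarrow> x1 s p = x1 t p \<and> x2 s p = x2 t p \<and> x4 s p = x4 t p"
    by (rule inj3[OF st]) (use that in blast)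
  show "s = t" if "\<And>p. p \<in> P \<Longrightarrow> x1 s p = x1 t p \<and> x3 s p = x3 t p \<and> x4 s p = x4 t p"
    by (rule inj2[OF st]) (use that in blast)
  show "s = t" if "\<And>p. p \<in> P \<Longrightarrow> x1 s p = x1 t p \<and> x3 s p = x3 t p \<and> x2 s p = x2 t p"
    by (rule inj4[OF st]) (use that in blast)
qed

lemma swap34: "tied_family S P k x1 x2 x4 x3"
proof unfold_locales
  show "finite S" "finite P" by (fact finite_S finite_P)+
  show "1 \<le> k p" if "p \<in> P" for p using that by (rule k_pos)
next
  fix s p assume "s \<in> S" "p \<in> P"
  then show "x1 s p \<le> k p \<and> x2 s p \<le> k p \<and> x4 s p \<le> k p \<and> x3 s p \<le> k p"
    using bounds by blast
  show "min_tied (x1 s p) (x2 s p) (x4 s p) (x3 s p)"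
    using tied[OF \<open>s \<in> S\<close> \<open>p \<in> P\<close>] unfolding min_tied_def by (elim disjE) auto
next
  fix s t assume st: "s \<in> S" "t \<in> S"
  show "s = t" if "\<And>p. p \<in> P \<Longrightarrow> x2 s p = x2 t p \<and> x4 s p = x4 t p \<and> x3 s p = x3 t p"
    by (rule inj1[OF st]) (use that in blast)
  show "s = t" if "\<And>p. p \<in> P \<Longrightarrow> x1 s p = x1 t p \<and> x4 s p = x4 t p \<and> x3 s p = x3 t p"
    by (rule inj2[OF st]) (use that in blast)
  show "s = t" if "\<And>p. p \<in> P \<Longrightarrow> x1 s p = x1 t p \<and> x2 s p = x2 t p \<and> x3 s p = x3 t p"
    by (rule inj4[OF st]) (use that in blast)
  show "s = t" if "\<And>p. p \<in> P \<Longrightarrow> x1 s p = x1 t p \<and> x2 s p = x2 t p \<and> x4 s p = x4 t p"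
    by (rule inj3[OF st]) (use that in blast)
qed

end

text \<open>Brings each of the five pairs other than 1, 2 to the front.\<close>

lemma (in tied_family) reorder:
  "tied_family S P k x1 x3 x2 x4" "tied_family S P k x1 x4 x2 x3" "tied_family S P k x2 x3 x1 x4"
  "tied_family S P k x2 x4 x1 x3" "tied_family S P k x3 x4 x1 x2"
proof -
  interpret a: tied_family S P k x1 x3 x2 x4 by (rule swap23)
  interpret b: tied_family S P k x1 x3 x4 x2 by (rule a.swap34)
  interpret c: tied_family S P k x1 x4 x3 x2 by (rule b.swap23)
  interpret d: tied_family S P k x3 x1 x2 x4 by (rule a.swap12)
  interpret e: tied_family S P k x3 x2 x1 x4 by (rule d.swap23)
  interpret f: tied_family S P k x3 x1 x4 x2 by (rule b.swap12)
  interpret g: tied_family S P k x3 x4 x1 x2 by (rule f.swap23)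
  interpret h: tied_family S P k x2 x1 x3 x4 by (rule swap12)
  interpret i: tied_family S P k x2 x1 x4 x3 by (rule h.swap34)
  show "tied_family S P k x1 x3 x2 x4" by (rule swap23)
  show "tied_family S P k x1 x4 x2 x3" by (rule c.swap34)
  show "tied_family S P k x2 x3 x1 x4" by (rule e.swap12)
  show "tied_family S P k x2 x4 x1 x3" by (rule i.swap23)
  show "tied_family S P k x3 x4 x1 x2" by (rule g.tied_family_axioms)
qed

section \<open>The weight from two triples sharing coordinates 1 and 2\<close>

text \<open>The factor guaranteed by the weight at one prime; \<open>B\<close> collects primes where
  coordinates 1 and 2 are known to agree.\<close>

definition pair_gain :: "'p set \<Rightarrow> ('p \<Rightarrow> nat) \<Rightarrow> 'p \<Rightarrow> real" where
  "pair_gain B k p = (if p \<in> B then 1 / (real (k p) + 1)\<^sup>2 else if k p = 1 then 1 / 8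
     else gain / (real (k p) + 1) ^ 3)"

text \<open>Geometric mean of weights on the triples 1, 2, 3 and 1, 2, 4. Both contain coordinates 1
  and 2, so both profit from a tie between them.\<close>

lemma (in tied_family) pair_weight_exists:
  assumes B: "\<And>s p. s \<in> S \<Longrightarrow> p \<in> P \<Longrightarrow> p \<in> B \<Longrightarrow> x1 s p = x2 s p"
  obtains W where "sum W S \<le> 1" "\<And>s. s \<in> S \<Longrightarrow> (\<Prod>p\<in>P. pair_gain B k p) \<le> W s"
    "\<And>s. 0 \<le> W s"
proof -
  \<comment> \<open>On \<open>B\<close> this is uniform on the (k + 1)^2 triples with equal first
    two entries; elsewhere it is uniform at exponent 1 and the scaled \<open>pair_weight\<close>
    above that.\<close>
  define \<nu> where "\<nu> p v = (if p \<in> B then of_bool (fst v = fst (snd v)) / (real (k p) + 1)\<^sup>2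
    else if k p = 1 then 1 / 8 else pair_weight v / (real (k p) + 1) ^ 3)" for p v
  define A where "A p = {..k p} \<times> {..k p} \<times> {..k p}" for p
  have nu_nonneg: "0 \<le> \<nu> p v" for p v
    using pair_weight_pos[of v] by (auto simp: \<nu>_def)
  have nu_le_1: "(\<Sum>v\<in>A p. \<nu> p v) \<le> 1" if p: "p \<in> P" for p
  proof -
    consider "p \<in> B" | "p \<notin> B" "k p = 1" | "p \<notin> B" "2 \<le> k p"
      using k_pos[OF p] by force
    then show ?thesis
    proof cases
      case 1
      have "(\<Sum>v\<in>A p. \<nu> p v) = (\<Sum>x\<le>k p. \<Sum>y\<le>k p. \<Sum>z\<le>k p. of_bool (x = y) / (real (k p) + 1)\<^sup>2)"
        using 1 by (simp add: A_def \<nu>_def sum.cartesian_product split_def del: sum_constant sum_divide_distrib)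
      also have "\<dots> = (\<Sum>x\<le>k p. \<Sum>y\<le>k p. if x = y then 1 / (real (k p) + 1) else 0)"
        by (intro sum.cong refl) (simp add: power2_eq_square divide_simps)
      also have "\<dots> = 1" by (simp add: sum.delta)
      finally show ?thesis by simp
    next
      case 2
      then show ?thesis by (simp add: A_def \<nu>_def)
    next
      case 3
      then have "(\<Sum>v\<in>A p. \<nu> p v) = (\<Sum>v\<in>A p. pair_weight v) / (real (k p) + 1) ^ 3"
        by (simp add: \<nu>_def sum_divide_distrib)
      also have "\<dots> \<le> 1"
        using sum_pair_weight_le[OF 3(2)] by (simp add: A_def)
      finally show ?thesis .
    qed
  qed
  define W1 where "W1 s = (\<Prod>p\<in>P. \<nu> p (x1 s p, x2 s p, x3 s p))" for s
  define W2 where "W2 s = (\<Prod>p\<in>P. \<nu> p (x1 s p, x2 s p, x4 s p))" for s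
  define W where "W s = W1 s powr (1 - 1 / 2) * W2 s powr (1 / 2)" for s
  have nonneg: "0 \<le> W1 s" "0 \<le> W2 s" for s
    by (simp_all add: W1_def W2_def nu_nonneg prod_nonneg)
  have "sum W1 S \<le> 1" unfolding W1_def
    by (rule sum_prod_weight_le_1[where A=A])
      (use finite_P bounds nu_nonneg nu_le_1 inj4 in \<open>auto simp: A_def\<close>)
  moreover have "sum W2 S \<le> 1" unfolding W2_def
    by (rule sum_prod_weight_le_1[where A=A])
      (use finite_P bounds nu_nonneg nu_le_1 inj3 in \<open>auto simp: A_def\<close>)
  ultimately have "sum W S \<le> 1"
    unfolding W_def by (intro sum_powr_mean_le_1 nonneg) auto
  moreover have "(\<Prod>p\<in>P. pair_gain B k p) \<le> W s" if s: "s \<in> S" for s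
  proof -
    have local: "(pair_gain B k p)\<^sup>2 \<le> \<nu> p (x1 s p, x2 s p, x3 s p) * \<nu> p (x1 s p, x2 s p, x4 s p)"
      if p: "p \<in> P" for p
    proof -
      consider "p \<in> B" | "p \<notin> B" "k p = 1" | "p \<notin> B" "2 \<le> k p"
        using k_pos[OF p] by force
      then show ?thesis
      proof cases
        case 3
        then show ?thesis
          using divide_right_mono[OF pair_weight_mult_ge[OF tied[OF s p]], of "(real (k p) + 1) ^ 3 * (real (k p) + 1) ^ 3"]
          by (simp add: pair_gain_def \<nu>_def power2_eq_square)
      qed (use B[OF s p] in \<open>auto simp: pair_gain_def \<nu>_def power2_eq_square\<close>)
    qed
    have pos: "0 \<le> (\<Prod>p\<in>P. pair_gain B k p)"
      by (intro prod_nonneg) (auto simp: pair_gain_def gain_def)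
    have "(\<Prod>p\<in>P. pair_gain B k p)\<^sup>2 \<le> W1 s * W2 s"
      unfolding W1_def W2_def prod_power_distrib prod.distrib[symmetric]
      by (intro prod_mono conjI local) auto
    then have "sqrt ((\<Prod>p\<in>P. pair_gain B k p)\<^sup>2) \<le> sqrt (W1 s * W2 s)"
      by (rule real_sqrt_le_mono)
    then show ?thesis
      using pos nonneg by (simp add: W_def powr_half_sqrt real_sqrt_mult)
  qed
  moreover have "0 \<le> W s" for s by (simp add: W_def)
  ultimately show thesis using that by blast
qed

section \<open>The weight for (a): four triples and the ratios\<close>

text \<open>
  Rounded numerical solution of the minimax problem for the geometric mean with exponents 7/32 for each of
  the four triples and 1/8 for the ratio weight, whose optimal value is about 7.8628. The first
  argument is the exponent of the partner (under the pairing 12|34) of the omitted coordinate.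
\<close>
definition triple_weight :: "nat \<times> nat \<times> nat \<Rightarrow> real" where
  "triple_weight = (\<lambda>(x, y, z).
     if x = y \<and> y = z then 121 / 1000
     else if y = z then if x = 0 then 85 / 1000 else 141 / 1000
     else if x = 0 then 158 / 1000 else 108 / 1000)"

text \<open>The arguments are the exponents of a prime in d1/d2 and d3/d4.\<close>
definition ratio_weight :: "int \<times> int \<Rightarrow> real" where
  "ratio_weight = (\<lambda>(a, b).
     if a = 0 \<and> b = 0 then 364 / 1000 else if a = 0 \<or> b = 0 then 54 / 1000 else 105 / 1000)"

definition scale_weight :: "nat \<times> nat \<times> nat \<times> nat \<Rightarrow> real" where
  "scale_weight = (\<lambda>(a, b, c, d). if a = b \<and> b = c \<and> c = d then 1 / 2 else 1)"

text \<open>One inequality per type of tied binary pattern: all entries equal; three zeros and a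
  one; two zeros at the pair 12 or 34; one zero in each of these pairs. The first is stated as a
  fourth root, the last two as square roots. The value 787/100 lies between the optimum and
  7.8784716.\<close>

lemma certificate_constants:
  "(100 / 787 :: real) ^ 8 \<le> (121 / 1000) ^ 7 * (182 / 1000)"
  "(100 / 787 :: real) ^ 32 \<le> (121 / 1000 * (141 / 1000) * (158 / 1000)\<^sup>2) ^ 7 * (54 / 1000) ^ 4"
  "(100 / 787 :: real) ^ 16 \<le> (141 / 1000 * (85 / 1000)) ^ 7 * (364 / 1000) ^ 2"
  "(100 / 787 :: real) ^ 16 \<le> (158 / 1000 * (108 / 1000)) ^ 7 * (105 / 1000) ^ 2"
  by (simp_all add: power_divide power_mult_distrib)

text \<open>The mean with exponents 7/32 and 1/8, raised to the power 32 so that only integer powers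
  of rationals are compared.\<close>

lemma local_certificate:
  assumes "a \<le> 1" "b \<le> 1" "c \<le> 1" "d \<le> 1" "min_tied a b c d"
  shows "(100 / 787) ^ 32 \<le>
    (triple_weight (b, c, d) * triple_weight (a, c, d) * (triple_weight (d, a, b) * triple_weight (c, a, b))) ^ 7
    * (ratio_weight (int a - int b, int c - int d) * scale_weight (a, b, c, d)) ^ 4"
    (is "_ \<le> ?T ^ 7 * ?R ^ 4")
proof -
  have "a = 0 \<or> a = 1" "b = 0 \<or> b = 1" "c = 0 \<or> c = 1" "d = 0 \<or> d = 1"
    using assms(1-4) by auto
  then have "?T = (121 / 1000) ^ 4 \<and> ?R = 182 / 1000
    \<or> ?T = 121 / 1000 * (141 / 1000) * (158 / 1000)\<^sup>2 \<and> ?R = 54 / 1000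
    \<or> ?T = (141 / 1000 * (85 / 1000))\<^sup>2 \<and> ?R = 364 / 1000
    \<or> ?T = (158 / 1000 * (108 / 1000))\<^sup>2 \<and> ?R = 105 / 1000"
    using assms(5)
    by (elim disjE)
      (simp_all add: triple_weight_def ratio_weight_def scale_weight_def min_tied_def power_divide)
  then show ?thesis
  proof (elim disjE conjE)
    assume eq: "?T = (121 / 1000) ^ 4" "?R = 182 / 1000"
    have "((100 / 787 :: real) ^ 8) ^ 4 \<le> ((121 / 1000) ^ 7 * (182 / 1000)) ^ 4"
      by (intro power_mono certificate_constants(1)) simp
    then show ?thesis unfolding eq power_mult_distrib power_mult[symmetric]
      by (simp only: mult.commute[of 7 4]) simp
  next
    assume eq: "?T = 121 / 1000 * (141 / 1000) * (158 / 1000)\<^sup>2" "?R = 54 / 1000"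
    show ?thesis unfolding eq by (rule certificate_constants(2))
  next
    assume eq: "?T = (141 / 1000 * (85 / 1000))\<^sup>2" "?R = 364 / 1000"
    have "((100 / 787 :: real) ^ 16) ^ 2 \<le> ((141 / 1000 * (85 / 1000)) ^ 7 * (364 / 1000) ^ 2) ^ 2"
      by (intro power_mono certificate_constants(3)) simp
    then show ?thesis unfolding eq power_mult_distrib power_mult[symmetric] by simp
  next
    assume eq: "?T = (158 / 1000 * (108 / 1000))\<^sup>2" "?R = 105 / 1000"
    have "((100 / 787 :: real) ^ 16) ^ 2 \<le> ((158 / 1000 * (108 / 1000)) ^ 7 * (105 / 1000) ^ 2) ^ 2"
      by (intro power_mono certificate_constants(4)) simp
    then show ?thesis unfolding eq power_mult_distrib power_mult[symmetric] by simp
  qed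
qed

lemma atMost_1: "{..1::nat} = {0, 1}" by auto

lemma sum_triple_weight: "(\<Sum>v\<in>{..1} \<times> {..1} \<times> {..1}. triple_weight v) = 1"
  unfolding sum.cartesian_product' by (simp add: atMost_1 triple_weight_def del: One_nat_def)

lemma sum_ratio_weight: "(\<Sum>v\<in>{-1, 0, 1} \<times> {-1, 0, 1}. ratio_weight v) = 1"
  unfolding sum.cartesian_product' by (simp add: ratio_weight_def)

text \<open>\<open>V\<close> stands for the patterns at one prime among solutions with the same
  ratios: either a single pattern, or at most the two constant ones, which share the mass.\<close>

lemma scale_weight_sum_le:
  assumes "\<And>v. v \<in> V \<Longrightarrow> v = v0 \<or> (v0 \<in> {(0,0,0,0),(1,1,1,1)} \<and> v \<in> {(0,0,0,0),(1,1,1,1)})"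
  shows "(\<Sum>v\<in>V. scale_weight v) \<le> 1"
proof -
  have pos: "0 \<le> scale_weight v" for v by (auto simp: scale_weight_def split: prod.splits)
  show ?thesis
  proof (cases "v0 \<in> {(0,0,0,0),(1,1,1,1)}")
    case True
    then have "V \<subseteq> {(0,0,0,0),(1,1,1,1)}" using assms by blast
    then have "(\<Sum>v\<in>V. scale_weight v) \<le> (\<Sum>v\<in>{(0,0,0,0),(1,1,1,1)}. scale_weight v)"
      by (intro sum_mono2 pos) auto
    then show ?thesis by (simp add: scale_weight_def)
  next
    case False
    then have "V \<subseteq> {v0}" using assms by blast
    then have "(\<Sum>v\<in>V. scale_weight v) \<le> (\<Sum>v\<in>{v0}. scale_weight v)"
      by (intro sum_mono2 pos) auto
    also have "\<dots> \<le> 1" by (auto simp: scale_weight_def split: prod.splits)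
    finally show ?thesis .
  qed
qed

definition tied_patterns :: "nat \<Rightarrow> (nat \<times> nat \<times> nat \<times> nat) set" where
  "tied_patterns k = {(a, b, c, d) \<in> {..k} \<times> {..k} \<times> {..k} \<times> {..k}. min_tied a b c d}"

lemma finite_tied_patterns: "finite (tied_patterns k)"
  by (rule finite_subset[of _ "{..k} \<times> {..k} \<times> {..k} \<times> {..k}"]) (auto simp: tied_patterns_def)

text \<open>A tied pattern repeats a value at one of six pairs of positions, leaving three free
  values.\<close>

lemma card_tied_patterns_le: "card (tied_patterns k) \<le> 6 * (k + 1) ^ 3"
proof -
  let ?B = "{..k} \<times> {..k} \<times> {..k}"
  define \<F> :: "(nat \<times> nat \<times> nat \<Rightarrow> nat \<times> nat \<times> nat \<times> nat) list" where
    "\<F> = [\<lambda>(a, b, c). (a, a, b, c), \<lambda>(a, b, c). (a, b, a, c), \<lambda>(a, b, c). (a, b, c, a),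
      \<lambda>(a, b, c). (b, a, a, c), \<lambda>(a, b, c). (b, a, c, a), \<lambda>(a, b, c). (b, c, a, a)]"
  have cardB: "card ?B = (k + 1) ^ 3" by (simp add: power3_eq_cube)
  have "tied_patterns k \<subseteq> (\<Union>F\<in>set \<F>. F ` ?B)"
  proof
    fix v assume "v \<in> tied_patterns k"
    then obtain a b c d where v: "v = (a, b, c, d)" "a \<le> k" "b \<le> k" "c \<le> k" "d \<le> k" "min_tied a b c d"
      by (auto simp: tied_patterns_def)
    then consider "a = b" | "a = c" | "a = d" | "b = c" | "b = d" | "c = d"
      unfolding min_tied_def by blast
    then show "v \<in> (\<Union>F\<in>set \<F>. F ` ?B)"
      by cases (use v in \<open>auto simp: \<F>_def image_iff\<close>)
  qed
  then have "card (tied_patterns k) \<le> card (\<Union>F\<in>set \<F>. F ` ?B)"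
    by (intro card_mono) auto
  also have "\<dots> \<le> (\<Sum>F\<in>set \<F>. card (F ` ?B))" by (intro card_UN_le) simp
  also have "\<dots> \<le> (\<Sum>F\<in>set \<F>. (k + 1) ^ 3)"
    unfolding cardB[symmetric] by (intro sum_mono card_image_le) simp
  also have "\<dots> \<le> 6 * (k + 1) ^ 3"
    using card_length[of \<F>] by (simp add: \<F>_def)
  finally show ?thesis .
qed

text \<open>The certified constant at exponent 1, and the crude count of tied patterns
  elsewhere.\<close>

definition quad_gain :: "('p \<Rightarrow> nat) \<Rightarrow> 'p \<Rightarrow> real" where
  "quad_gain k p = (if k p = 1 then 100 / 787 else 1 / (6 * (real (k p) + 1) ^ 3))"

text \<open>The hypothesis \<open>rigid\<close> says that equal ratios x1 - x2 and x3 - x4 at all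
  primes force equal x1 - x3; it is written additively to avoid truncated subtraction. The keys are
  the ratios at primes of exponent 1, and only a common shift is left to be weighted there.\<close>

lemma (in tied_family) ratio_weight_exists:
  assumes rigid: "\<And>s t. s \<in> S \<Longrightarrow> t \<in> S \<Longrightarrow>
      (\<And>p. p \<in> P \<Longrightarrow> x1 s p + x2 t p = x2 s p + x1 t p \<and> x3 s p + x4 t p = x4 s p + x3 t p) \<Longrightarrow>
      (\<forall>p\<in>P. x1 s p + x3 t p = x3 s p + x1 t p)"
  defines "g \<equiv> \<lambda>s p. if k p = 1
      then ratio_weight (int (x1 s p) - int (x2 s p), int (x3 s p) - int (x4 s p))
        * scale_weight (x1 s p, x2 s p, x3 s p, x4 s p)
      else 1 / (6 * (real (k p) + 1) ^ 3)"
  shows "(\<Sum>s\<in>S. \<Prod>p\<in>P. g s p) \<le> 1"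
proof -
  define f where "f s p = (x1 s p, x2 s p, x3 s p, x4 s p)" for s p
  define emb :: "nat \<times> nat \<times> nat \<times> nat \<Rightarrow> int \<times> int \<times> int \<times> int"
    where "emb = (\<lambda>(a, b, c, d). (int a, int b, int c, int d))"
  \<comment> \<open>At primes of exponent above 1 the key is the whole pattern, so that it stays constant on the fibres.\<close>
  define key where "key s p = (if k p = 1
      then (int (x1 s p) - int (x2 s p), int (x3 s p) - int (x4 s p), 0, 0) else emb (f s p))" for s p
  define K where "K p = (if k p = 1 then {-1, 0, 1} \<times> {-1, 0, 1} \<times> {0} \<times> {0}
      else emb ` tied_patterns (k p))" for p
  define w where "w p y = (if k p = 1 then ratio_weight (fst y, fst (snd y))
      else 1 / (6 * (real (k p) + 1) ^ 3))" for p and y :: "int \<times> int \<times> int \<times> int"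
  define v where "v p y = (if k p = 1 then scale_weight y else 1)" for p y
  have "(\<Sum>s\<in>S. \<Prod>p\<in>P. w p (key s p) * v p (f s p)) \<le> 1"
  proof (rule sum_prod_key_weight_le_1[where K=K and key=key and f=f and w=w and v=v])
    show "finite P" "finite S" by (fact finite_P finite_S)+
    show "finite (K p)" for p by (simp add: K_def finite_tied_patterns)
    show "s = t" if "s \<in> S" "t \<in> S" "\<And>p. p \<in> P \<Longrightarrow> f s p = f t p" for s t
      by (rule inj1[OF that(1,2)]) (use that(3) in \<open>auto simp: f_def\<close>)
    show "0 \<le> w p y" for p y by (auto simp: w_def ratio_weight_def)
    show "0 \<le> v p y" for p y by (auto simp: v_def scale_weight_def split: prod.splits)
  next
    fix s p assume sp: "s \<in> S" "p \<in> P"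
    show "key s p \<in> K p"
    proof (cases "k p = 1")
      case True
      then have "x1 s p = 0 \<or> x1 s p = 1" "x2 s p = 0 \<or> x2 s p = 1"
        "x3 s p = 0 \<or> x3 s p = 1" "x4 s p = 0 \<or> x4 s p = 1"
        using bounds[OF sp] by auto
      then show ?thesis using True by (elim disjE) (simp_all add: key_def K_def)
    next
      case False
      have "f s p \<in> tied_patterns (k p)"
        using bounds[OF sp] tied[OF sp] by (simp add: f_def tied_patterns_def)
      then show ?thesis using False by (simp add: key_def K_def)
    qed
  next
    fix p assume "p \<in> P"
    show "(\<Sum>y\<in>K p. w p y) \<le> 1"
    proof (cases "k p = 1")
      case True
      have "(\<Sum>y\<in>K p. w p y) = (\<Sum>y\<in>{-1, 0, 1} \<times> {-1, 0, 1}. ratio_weight y)"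
        by (rule sum.reindex_bij_witness[of _ "\<lambda>(a, b). (a, b, 0, 0)" "\<lambda>(a, b, c, d). (a, b)"])
          (use True in \<open>auto simp: K_def w_def\<close>)
      then show ?thesis by (simp only: sum_ratio_weight)
    next
      case False
      have "card (K p) \<le> 6 * (k p + 1) ^ 3"
        using False card_image_le[OF finite_tied_patterns[of "k p"], of emb] card_tied_patterns_le[of "k p"]
        by (simp add: K_def)
      then have "real (card (K p)) \<le> real (6 * (k p + 1) ^ 3)" by (rule of_nat_mono)
      then show ?thesis
        using False by (simp add: w_def add.commute[of 1])
    qed
  next
    fix s p assume sp: "s \<in> S" "p \<in> P"
    let ?F = "{t \<in> S. \<forall>q\<in>P. key t q = key s q}"
    have ratios: "x1 s q + x2 t q = x2 s q + x1 t q \<and> x3 s q + x4 t q = x4 s q + x3 t q"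
      if "t \<in> ?F" "q \<in> P" for t q
    proof -
      have "key t q = key s q" using that by blast
      then show ?thesis by (auto simp: key_def emb_def f_def split: if_splits)
    qed
    show "(\<Sum>y\<in>(\<lambda>t. f t p) ` ?F. v p y) \<le> 1"
    proof (cases "k p = 1")
      case True
      have "(\<Sum>y\<in>(\<lambda>t. f t p) ` ?F. scale_weight y) \<le> 1"
      proof (rule scale_weight_sum_le[where ?v0.0="f s p"])
        fix y assume "y \<in> (\<lambda>t. f t p) ` ?F"
        then obtain t where t: "t \<in> ?F" "y = f t p" by blast
        \<comment> \<open>With the two ratios this makes all four exponents at \<open>p\<close>
          shift by the same amount; since they lie in {0, 1}, a nonzero shift exchanges the two
          constant patterns.\<close>
        have "x1 s p + x3 t p = x3 s p + x1 t p"
          using rigid[of s t] ratios[OF t(1)] sp t(1) by blast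
        moreover note ratios[OF t(1) sp(2)]
        moreover have "x1 s p \<le> 1" "x2 s p \<le> 1" "x3 s p \<le> 1" "x4 s p \<le> 1"
          using bounds[OF sp] True by auto
        moreover have "x1 t p \<le> 1" "x2 t p \<le> 1" "x3 t p \<le> 1" "x4 t p \<le> 1"
          using bounds[of t p] sp t(1) True by auto
        ultimately consider
            "x1 t p = x1 s p" "x2 t p = x2 s p" "x3 t p = x3 s p" "x4 t p = x4 s p"
          | "x1 s p = 0" "x2 s p = 0" "x3 s p = 0" "x4 s p = 0" "x1 t p = 1" "x2 t p = 1" "x3 t p = 1" "x4 t p = 1"
          | "x1 s p = 1" "x2 s p = 1" "x3 s p = 1" "x4 s p = 1" "x1 t p = 0" "x2 t p = 0" "x3 t p = 0" "x4 t p = 0"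
          by linarith
        then show "y = f s p \<or> f s p \<in> {(0,0,0,0),(1,1,1,1)} \<and> y \<in> {(0,0,0,0),(1,1,1,1)}"
          unfolding t(2) f_def by cases simp_all
      qed
      then show ?thesis using True by (simp add: v_def)
    next
      case False
      have "(\<lambda>t. f t p) ` ?F \<subseteq> {f s p}"
      proof
        fix y assume "y \<in> (\<lambda>t. f t p) ` ?F"
        then obtain t where "t \<in> ?F" "y = f t p" by blast
        then have "emb y = emb (f s p)" using False sp by (auto simp: key_def)
        then show "y \<in> {f s p}" by (auto simp: emb_def split: prod.splits)
      qed
      then have "card ((\<lambda>t. f t p) ` ?F) \<le> card {f s p}" by (intro card_mono) auto
      then show ?thesis using False by (simp add: v_def)
    qed
  qed
  also have "(\<Sum>s\<in>S. \<Prod>p\<in>P. w p (key s p) * v p (f s p)) = (\<Sum>s\<in>S. \<Prod>p\<in>P. g s p)"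
    by (intro sum.cong prod.cong refl) (simp add: w_def v_def key_def f_def g_def)
  finally show ?thesis .
qed

lemma (in tied_family) quad_weight_exists:
  assumes rigid: "\<And>s t. s \<in> S \<Longrightarrow> t \<in> S \<Longrightarrow>
      (\<And>p. p \<in> P \<Longrightarrow> x1 s p + x2 t p = x2 s p + x1 t p \<and> x3 s p + x4 t p = x4 s p + x3 t p) \<Longrightarrow>
      (\<forall>p\<in>P. x1 s p + x3 t p = x3 s p + x1 t p)"
  obtains W where "sum W S \<le> 1" "\<And>s. s \<in> S \<Longrightarrow> (\<Prod>p\<in>P. quad_gain k p) \<le> W s"
    "\<And>s. 0 \<le> W s"
proof -
  define g where "g s p = (if k p = 1
      then ratio_weight (int (x1 s p) - int (x2 s p), int (x3 s p) - int (x4 s p))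
        * scale_weight (x1 s p, x2 s p, x3 s p, x4 s p)
      else 1 / (6 * (real (k p) + 1) ^ 3))" for s p
  define h where "h p v = (if k p = 1 then triple_weight v else 1 / (real (k p) + 1) ^ 3)" for p v
  define A where "A p = {..k p} \<times> {..k p} \<times> {..k p}" for p
  have h_nonneg: "0 \<le> h p v" for p v by (auto simp: h_def triple_weight_def split: prod.splits)
  have g_nonneg: "0 \<le> g s p" for p s
    by (auto simp: g_def ratio_weight_def scale_weight_def)
  have h_le_1: "(\<Sum>v\<in>A p. h p v) \<le> 1" if p: "p \<in> P" for p
  proof (cases "k p = 1")
    case True
    then show ?thesis using sum_triple_weight by (simp add: A_def h_def)
  next
    case False
    then show ?thesis by (simp add: A_def h_def power3_eq_cube field_simps)
  qed
  \<comment> \<open>\<open>T1\<close> to \<open>T4\<close> omit coordinates 1 to 4; the partner of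
    the omitted coordinate comes first.\<close>
  define T1 where "T1 s = (\<Prod>p\<in>P. h p (x2 s p, x3 s p, x4 s p))" for s
  define T2 where "T2 s = (\<Prod>p\<in>P. h p (x1 s p, x3 s p, x4 s p))" for s
  define T3 where "T3 s = (\<Prod>p\<in>P. h p (x4 s p, x1 s p, x2 s p))" for s
  define T4 where "T4 s = (\<Prod>p\<in>P. h p (x3 s p, x1 s p, x2 s p))" for s
  define R where "R s = (\<Prod>p\<in>P. g s p)" for s
  have T1: "sum T1 S \<le> 1" unfolding T1_def
    by (rule sum_prod_weight_le_1[where A=A])
      (use finite_P bounds h_nonneg h_le_1 inj1 in \<open>auto simp: A_def\<close>)
  have T2: "sum T2 S \<le> 1" unfolding T2_def
    by (rule sum_prod_weight_le_1[where A=A])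
      (use finite_P bounds h_nonneg h_le_1 inj2 in \<open>auto simp: A_def\<close>)
  have T3: "sum T3 S \<le> 1" unfolding T3_def
    by (rule sum_prod_weight_le_1[where A=A])
      (use finite_P bounds h_nonneg h_le_1 inj3 in \<open>auto simp: A_def\<close>)
  have T4: "sum T4 S \<le> 1" unfolding T4_def
    by (rule sum_prod_weight_le_1[where A=A])
      (use finite_P bounds h_nonneg h_le_1 inj4 in \<open>auto simp: A_def\<close>)
  have R: "sum R S \<le> 1"
    unfolding R_def g_def by (rule ratio_weight_exists) (fact rigid)
  have nonneg: "0 \<le> T1 s" "0 \<le> T2 s" "0 \<le> T3 s" "0 \<le> T4 s" "0 \<le> R s" for s
    by (simp_all add: T1_def T2_def T3_def T4_def R_def h_nonneg g_nonneg prod_nonneg)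
  \<comment> \<open>Nested means of two: each triple gets exponent 1/4 in \<open>M\<close>, hence
    7/32 in \<open>W\<close>, and the ratios get 1/8.\<close>
  define M12 where "M12 s = T1 s powr (1 - 1 / 2) * T2 s powr (1 / 2)" for s
  define M34 where "M34 s = T3 s powr (1 - 1 / 2) * T4 s powr (1 / 2)" for s
  define M where "M s = M12 s powr (1 - 1 / 2) * M34 s powr (1 / 2)" for s
  define W where "W s = M s powr (1 - 1 / 8) * R s powr (1 / 8)" for s
  have "sum M12 S \<le> 1" "sum M34 S \<le> 1"
    unfolding M12_def M34_def by (intro sum_powr_mean_le_1 nonneg T1 T2 T3 T4; simp)+
  then have "sum M S \<le> 1"
    unfolding M_def by (intro sum_powr_mean_le_1) (simp_all add: M12_def M34_def)
  then have W: "sum W S \<le> 1"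
    unfolding W_def by (intro sum_powr_mean_le_1 nonneg R) (simp_all add: M_def)
  have W_eq: "W s = ((T1 s * T2 s * (T3 s * T4 s)) ^ 7 * R s ^ 4) powr (1 / 32)" for s
  proof -
    have "(x ^ 7) powr (1 / 32) = x powr (7 / 32)" "(x ^ 4) powr (1 / 32) = x powr (1 / 8)"
      if "0 \<le> x" for x :: real
      using powr_powr[of x 7 "1 / 32"] powr_powr[of x 4 "1 / 32"] that by simp_all
    then show ?thesis
      using nonneg[of s]
      by (simp add: W_def M_def M12_def M34_def powr_mult powr_powr power_mult_distrib)
  qed
  have "(\<Prod>p\<in>P. quad_gain k p) \<le> W s" if s: "s \<in> S" for s
  proof -
    have local: "quad_gain k p ^ 32 \<le> (h p (x2 s p, x3 s p, x4 s p) * h p (x1 s p, x3 s p, x4 s p)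
        * (h p (x4 s p, x1 s p, x2 s p) * h p (x3 s p, x1 s p, x2 s p))) ^ 7 * g s p ^ 4"
      if p: "p \<in> P" for p
    proof (cases "k p = 1")
      case True
      then show ?thesis
        using local_certificate[OF _ _ _ _ tied[OF s p]] bounds[OF s p]
        by (simp add: quad_gain_def h_def g_def)
    next
      case False
      define q where "q = 1 / (real (k p) + 1) ^ 3"
      have "quad_gain k p ^ 32 = (1 / 6) ^ 32 * q ^ 32"
        using False by (simp add: quad_gain_def q_def power_divide power_mult_distrib)
      \<comment> \<open>Only the ratio weight carries the factor 1/6, so the full 1/6 in
        \<open>quad_gain\<close> is generous.\<close>
      also have "\<dots> \<le> (1 / 6) ^ 4 * q ^ 32"
        by (intro mult_right_mono) (simp_all add: q_def)
      also have "\<dots> = (q * q * (q * q)) ^ 7 * (q / 6) ^ 4"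
        by (simp add: power_mult_distrib power_divide flip: power_add)
      finally show ?thesis
        using False by (simp add: h_def g_def q_def mult.commute[of 6])
    qed
    have pos: "0 \<le> (\<Prod>p\<in>P. quad_gain k p)"
      by (intro prod_nonneg) (auto simp: quad_gain_def)
    have "(\<Prod>p\<in>P. quad_gain k p) ^ 32 \<le> (T1 s * T2 s * (T3 s * T4 s)) ^ 7 * R s ^ 4"
      unfolding T1_def T2_def T3_def T4_def R_def prod.distrib[symmetric] prod_power_distrib
      by (intro prod_mono conjI local) (auto simp: quad_gain_def)
    then have "((\<Prod>p\<in>P. quad_gain k p) ^ 32) powr (1 / 32) \<le> W s"
      unfolding W_eq using pos by (intro powr_mono2) auto
    also have "((\<Prod>p\<in>P. quad_gain k p) ^ 32) powr (1 / 32) = (\<Prod>p\<in>P. quad_gain k p)"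
    proof -
      have "(x ^ 32) powr (1 / 32) = x" if "0 \<le> x" for x :: real
        using powr_powr[of x 32 "1 / 32"] that by simp
      then show ?thesis using pos by blast
    qed
    finally show ?thesis .
  qed
  moreover have "0 \<le> W s" for s by (simp add: W_def)
  ultimately show thesis using that W by blast
qed

subsection \<open>Solutions among the divisors of an integer\<close>

definition solutions :: "nat set \<Rightarrow> (nat \<times> nat \<times> nat \<times> nat) set" where
  "solutions A = {(d1, d2, d3, d4). d1 \<in> A \<and> d2 \<in> A \<and> d3 \<in> A \<and> d4 \<in> A \<and> d1 + d2 = d3 + d4}"

lemma min_tiedI:
  assumes "\<not> (a < b \<and> a < c \<and> a < d)" "\<not> (b < a \<and> b < c \<and> b < d)"
    "\<not> (c < a \<and> c < b \<and> c < d)" "\<not> (d < a \<and> d < b \<and> d < c)"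
  shows "min_tied a b c d"
proof -
  consider "a \<le> b" "a \<le> c" "a \<le> d" | "b \<le> a" "b \<le> c" "b \<le> d"
    | "c \<le> a" "c \<le> b" "c \<le> d" | "d \<le> a" "d \<le> b" "d \<le> c"
    by linarith
  then show ?thesis
    using assms unfolding min_tied_def by cases auto
qed

text \<open>If one term had the strictly smallest exponent e of p, then p^(e+1) would divide the
  other three terms, and hence by the equation this one too.\<close>

lemma min_tied_multiplicity:
  fixes a b c d p :: nat
  assumes p: "prime p" and pos: "a > 0" "b > 0" "c > 0" "d > 0" and eq: "a + b = c + d"
  shows "min_tied (multiplicity p a) (multiplicity p b) (multiplicity p c) (multiplicity p d)"
proof -
  have impossible: False
    if "multiplicity p w < multiplicity p x" "multiplicity p w < multiplicity p y"
      "multiplicity p w < multiplicity p z" and wx: "w + x = y + z" and "w > 0" for w x y z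
  proof -
    let ?q = "p ^ Suc (multiplicity p w)"
    have "?q dvd x" "?q dvd y" "?q dvd z"
      using that by (intro multiplicity_dvd'; simp)+
    then have "?q dvd w" using wx by (metis dvd_add dvd_add_left_iff)
    then have "Suc (multiplicity p w) \<le> multiplicity p w"
      using \<open>w > 0\<close> p by (intro multiplicity_geI) auto
    then show False by simp
  qed
  show ?thesis
    using impossible[of a b c d] impossible[of b a c d] impossible[of c d a b] impossible[of d c a b] eq pos
    by (intro min_tiedI) auto
qed

lemma multiplicity_eq_on_prime_factors:
  fixes a b n :: nat
  assumes "n > 0" "a dvd n" "b dvd n"
    and "\<And>p. p \<in> prime_factors n \<Longrightarrow> multiplicity p a = multiplicity p b"
  shows "a = b"
proof (rule multiplicity_eq_nat)
  show "a > 0" "b > 0" using assms(1-3) by (auto intro: dvd_pos_nat)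
  fix p :: nat assume p: "prime p"
  show "multiplicity p a = multiplicity p b"
  proof (cases "p dvd n")
    case True
    then show ?thesis using p assms(1,4) by (simp add: prime_factors_dvd)
  next
    case False
    then have "\<not> p dvd a" "\<not> p dvd b" using assms(2,3) dvd_trans by blast+
    then show ?thesis by (simp add: not_dvd_imp_multiplicity_0)
  qed
qed

lemma cross_mult_eq:
  fixes a b a' b' n :: nat
  assumes "n > 0" "a dvd n" "b dvd n" "a' dvd n" "b' dvd n"
    and "\<And>p. p \<in> prime_factors n \<Longrightarrow> multiplicity p a + multiplicity p b' = multiplicity p b + multiplicity p a'"
  shows "a * b' = b * a'"
\<comment> \<open>\<open>n * n\<close> is a common multiple of both products with the same primes as
  \<open>n\<close>.\<close>
proof (rule multiplicity_eq_on_prime_factors[of "n * n"])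
  have pos: "a > 0" "b > 0" "a' > 0" "b' > 0" using assms(1-5) by (auto intro: dvd_pos_nat)
  show "n * n > 0" "a * b' dvd n * n" "b * a' dvd n * n" using assms by (auto intro: mult_dvd_mono)
  fix p assume "p \<in> prime_factors (n * n)"
  then have p: "p \<in> prime_factors n" using assms(1) by (auto simp: prime_factors_dvd prime_dvd_mult_iff)
  then have "prime p" by (rule in_prime_factors_imp_prime)
  then show "multiplicity p (a * b') = multiplicity p (b * a')"
    using assms(6)[OF p] pos by (simp add: prime_elem_multiplicity_mult_distrib)
qed

definition mult1 :: "nat \<times> nat \<times> nat \<times> nat \<Rightarrow> nat \<Rightarrow> nat" where "mult1 s p = multiplicity p (fst s)"
definition mult2 :: "nat \<times> nat \<times> nat \<times> nat \<Rightarrow> nat \<Rightarrow> nat" where "mult2 s p = multiplicity p (fst (snd s))"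
definition mult3 :: "nat \<times> nat \<times> nat \<times> nat \<Rightarrow> nat \<Rightarrow> nat" where "mult3 s p = multiplicity p (fst (snd (snd s)))"
definition mult4 :: "nat \<times> nat \<times> nat \<times> nat \<Rightarrow> nat \<Rightarrow> nat" where "mult4 s p = multiplicity p (snd (snd (snd s)))"

lemmas mult_defs = mult1_def mult2_def mult3_def mult4_def

lemma finite_solutions:
  assumes "n > 0"
  shows "finite (solutions (divisors n))"
proof (rule finite_subset)
  have "finite (divisors n)" using assms by (simp add: divisors_def)
  then show "finite (divisors n \<times> divisors n \<times> divisors n \<times> divisors n)" by auto
qed (auto simp: solutions_def)

lemma tied_family_solutions:
  assumes n: "n > 0"
  shows "tied_family (solutions (divisors n)) (prime_factors n) (\<lambda>p. multiplicity p n) mult1 mult2 mult3 mult4"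
proof unfold_locales
  show "finite (solutions (divisors n))" by (rule finite_solutions[OF n])
  show "finite (prime_factors n)" by simp
  show "1 \<le> multiplicity p n" if "p \<in> prime_factors n" for p
    using that n by (simp add: prime_factors_multiplicity Suc_le_eq)
next
  fix s p assume "s \<in> solutions (divisors n)" and p: "p \<in> prime_factors n"
  then obtain a b c d where s: "s = (a, b, c, d)" "a dvd n" "b dvd n" "c dvd n" "d dvd n" "a + b = c + d"
    by (auto simp: solutions_def divisors_def)
  then have pos: "a > 0" "b > 0" "c > 0" "d > 0" using n by (auto intro: dvd_pos_nat)
  show "mult1 s p \<le> multiplicity p n \<and> mult2 s p \<le> multiplicity p n \<and> mult3 s p \<le> multiplicity p n
      \<and> mult4 s p \<le> multiplicity p n"
    using s n by (auto simp: mult_defs intro: dvd_imp_multiplicity_le)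
  show "min_tied (mult1 s p) (mult2 s p) (mult3 s p) (mult4 s p)"
    unfolding mult_defs s(1) fst_conv snd_conv
    using p s(6) pos by (intro min_tied_multiplicity) (auto simp: prime_factors_dvd)
next
  fix s t assume "s \<in> solutions (divisors n)" "t \<in> solutions (divisors n)"
  then obtain a b c d a' b' c' d' where
    s: "s = (a, b, c, d)" "a dvd n" "b dvd n" "c dvd n" "d dvd n" "a + b = c + d" and
    t: "t = (a', b', c', d')" "a' dvd n" "b' dvd n" "c' dvd n" "d' dvd n" "a' + b' = c' + d'"
    by (auto simp: solutions_def divisors_def)
  note eqI = multiplicity_eq_on_prime_factors[OF n]
  show "s = t" if "\<And>p. p \<in> prime_factors n \<Longrightarrow> mult2 s p = mult2 t p \<and> mult3 s p = mult3 t p \<and> mult4 s p = mult4 t p"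
    using eqI[of b b'] eqI[of c c'] eqI[of d d'] that s t by (simp add: mult_defs)
  show "s = t" if "\<And>p. p \<in> prime_factors n \<Longrightarrow> mult1 s p = mult1 t p \<and> mult3 s p = mult3 t p \<and> mult4 s p = mult4 t p"
    using eqI[of a a'] eqI[of c c'] eqI[of d d'] that s t by (simp add: mult_defs)
  show "s = t" if "\<And>p. p \<in> prime_factors n \<Longrightarrow> mult1 s p = mult1 t p \<and> mult2 s p = mult2 t p \<and> mult4 s p = mult4 t p"
    using eqI[of a a'] eqI[of b b'] eqI[of d d'] that s t by (simp add: mult_defs)
  show "s = t" if "\<And>p. p \<in> prime_factors n \<Longrightarrow> mult1 s p = mult1 t p \<and> mult2 s p = mult2 t p \<and> mult3 s p = mult3 t p"
    using eqI[of a a'] eqI[of b b'] eqI[of c c'] that s t by (simp add: mult_defs)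
qed

text \<open>With N = d1 + d2 = d3 + d4, the ratio d1/d2 fixes d1/N and d3/d4 fixes d3/N, so together
  they fix d1/d3. This discharges the hypothesis \<open>rigid\<close>.\<close>

lemma solutions_rigid:
  assumes n: "n > 0" and "s \<in> solutions (divisors n)" "t \<in> solutions (divisors n)"
    and ratio: "\<And>p. p \<in> prime_factors n \<Longrightarrow>
      mult1 s p + mult2 t p = mult2 s p + mult1 t p \<and> mult3 s p + mult4 t p = mult4 s p + mult3 t p"
  shows "\<forall>p\<in>prime_factors n. mult1 s p + mult3 t p = mult3 s p + mult1 t p"
proof -
  obtain a b c d a' b' c' d' where
    s: "s = (a, b, c, d)" "a dvd n" "b dvd n" "c dvd n" "d dvd n" "a + b = c + d" and
    t: "t = (a', b', c', d')" "a' dvd n" "b' dvd n" "c' dvd n" "d' dvd n" "a' + b' = c' + d'"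
    using assms(2,3) by (auto simp: solutions_def divisors_def)
  have pos: "a > 0" "c > 0" "a' > 0" "c' > 0" using n s t by (auto intro: dvd_pos_nat)
  have cross: "a * b' = b * a'" "c * d' = d * c'"
    using ratio by (intro cross_mult_eq[OF n] s t; simp add: s(1) t(1) mult_defs)+
  have *: "(a + b) * a' = a * (a' + b')"
    using cross(1) by (simp add: algebra_simps)
  have **: "(a + b) * c' = c * (a' + b')"
    unfolding s(6) t(6) using cross(2) by (simp add: algebra_simps)
  have "(a * c') * ((a + b) * (a' + b')) = (c * a') * ((a + b) * (a' + b'))"
    using * ** by (metis mult.assoc mult.commute)
  then have "a * c' = c * a'" using pos by simp
  then have eq: "multiplicity p (a * c') = multiplicity p (c * a')" for p by simp
  show ?thesis
  proof
    fix p assume "p \<in> prime_factors n"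
    then have "prime p" by (rule in_prime_factors_imp_prime)
    then show "mult1 s p + mult3 t p = mult3 s p + mult1 t p"
      using eq[of p] pos by (simp add: s(1) t(1) mult_defs prime_elem_multiplicity_mult_distrib)
  qed
qed

text \<open>Distinct exponent vectors give distinct divisors.\<close>

lemma prod_multiplicity_le_tau:
  assumes n: "n > 0"
  shows "(\<Prod>p\<in>prime_factors n. multiplicity p n + 1) \<le> tau n"
proof -
  let ?P = "prime_factors n"
  let ?E = "PiE ?P (\<lambda>p. {..multiplicity p n})"
  have mult: "multiplicity q (\<Prod>p\<in>?P. p ^ f p) = (if q \<in> ?P then f q else 0)" if "prime q" for f q
    using that by (intro multiplicity_prod_prime_powers) (auto simp: prime_factors_dvd)
  have "inj_on (\<lambda>f. \<Prod>p\<in>?P. p ^ f p) ?E"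
  proof (rule inj_onI)
    fix f g assume fg: "f \<in> ?E" "g \<in> ?E" "(\<Prod>p\<in>?P. p ^ f p) = (\<Prod>p\<in>?P. p ^ g p)"
    show "f = g"
    proof (rule PiE_ext[OF fg(1,2)])
      fix q assume q: "q \<in> ?P"
      then have "prime q" by (rule in_prime_factors_imp_prime)
      then show "f q = g q" using mult[of q f] mult[of q g] fg(3) q by simp
    qed
  qed
  moreover have "(\<lambda>f. \<Prod>p\<in>?P. p ^ f p) ` ?E \<subseteq> divisors n"
  proof (clarsimp simp: divisors_def)
    fix f assume f: "f \<in> ?E"
    have "(\<Prod>p\<in>?P. p ^ f p) dvd (\<Prod>p\<in>?P. p ^ multiplicity p n)"
      using f by (intro prod_dvd_prod le_imp_power_dvd) auto
    then show "(\<Prod>p\<in>?P. p ^ f p) dvd n"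
      using prod_prime_factors[of n] n by simp
  qed
  ultimately have "card ?E \<le> card (divisors n)"
    using n by (intro card_inj_on_le[of "\<lambda>f. \<Prod>p\<in>?P. p ^ f p"]) (auto simp: divisors_def)
  then show ?thesis by (simp add: card_PiE tau_def)
qed

subsection \<open>Counting solutions\<close>

lemma (in tied_family) card_le_pair_bound:
  assumes "p0 \<in> P" and "\<And>s. s \<in> S \<Longrightarrow> x1 s p0 = x2 s p0"
  shows "real (card S) \<le> 1 / (\<Prod>p\<in>P. pair_gain {p0} k p)"
proof -
  obtain W where "sum W S \<le> 1" "\<And>s. s \<in> S \<Longrightarrow> (\<Prod>p\<in>P. pair_gain {p0} k p) \<le> W s"
    using pair_weight_exists[of "{p0}"] assms(2) by (metis singletonD)
  then show ?thesis
    by (rule card_le_of_weight) (auto simp: pair_gain_def gain_def intro!: prod_pos)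
qed

text \<open>Sort the solutions by a pair of positions that ties at \<open>p0\<close>; by symmetry
  each of the six classes obeys \<open>card_le_pair_bound\<close>.\<close>

lemma (in tied_family) card_le_six_pair_bounds:
  assumes p0: "p0 \<in> P"
  shows "real (card S) \<le> 6 / (\<Prod>p\<in>P. pair_gain {p0} k p)"
proof -
  define b where "b = 1 / (\<Prod>p\<in>P. pair_gain {p0} k p)"
  define S' where "S' x y = {s\<in>S. x s p0 = y s p0}" for x y :: "'s \<Rightarrow> 'p \<Rightarrow> nat"
  have *: "real (card (S' y1 y2)) \<le> b" if "tied_family S P k y1 y2 y3 y4" for y1 y2 y3 y4
  proof -
    interpret T: tied_family "S' y1 y2" P k y1 y2 y3 y4
      by (rule tied_family.subset[OF that]) (auto simp: S'_def)
    show ?thesis unfolding b_def by (rule T.card_le_pair_bound[OF p0]) (simp add: S'_def)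
  qed
  have "S \<subseteq> S' x1 x2 \<union> (S' x1 x3 \<union> (S' x1 x4 \<union> (S' x2 x3 \<union> (S' x2 x4 \<union> S' x3 x4))))"
    using tied[OF _ p0] by (auto simp: S'_def min_tied_def)
  then have "card S \<le> card (S' x1 x2 \<union> (S' x1 x3 \<union> (S' x1 x4 \<union> (S' x2 x3 \<union> (S' x2 x4 \<union> S' x3 x4)))))"
    using finite_S by (intro card_mono) (auto simp: S'_def)
  also have "\<dots> \<le> card (S' x1 x2) + (card (S' x1 x3) + (card (S' x1 x4) + (card (S' x2 x3)
      + (card (S' x2 x4) + card (S' x3 x4)))))"
    by (intro order_trans[OF card_Un_le] add_left_mono order_refl)
  finally have "real (card S) \<le> real (card (S' x1 x2)) + (real (card (S' x1 x3)) + (real (card (S' x1 x4))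
      + (real (card (S' x2 x3)) + (real (card (S' x2 x4)) + real (card (S' x3 x4))))))"
    by (simp flip: of_nat_add)
  also have "\<dots> \<le> b + (b + (b + (b + (b + b))))"
    by (intro add_mono *[OF tied_family_axioms] reorder[THEN *])
  finally show ?thesis by (simp add: b_def)
qed

text \<open>Relative to 1/(k + 1)^3, \<open>pair_gain\<close> saves k + 1 at \<open>p0\<close> and
  \<open>gain\<close> at the other primes of exponent at least 2; hence the exponent is one less
  than their number.\<close>

lemma (in tied_family) card_le_of_large_exponent:
  assumes p0: "p0 \<in> P" "k p0 \<noteq> 1"
  shows "real (card S) * (real (k p0) + 1) * gain ^ (card {p\<in>P. k p \<noteq> 1} - 1)
    \<le> 6 * (\<Prod>p\<in>P. real (k p) + 1) ^ 3"
proof -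
  let ?L = "{p\<in>P. k p \<noteq> 1}"
  have "(\<Prod>p\<in>P. pair_gain {p0} k p) * (\<Prod>p\<in>P. real (k p) + 1) ^ 3
      = (\<Prod>p\<in>P. if p = p0 then real (k p0) + 1 else if k p = 1 then 1 else gain)"
    unfolding prod_power_distrib prod.distrib[symmetric]
    by (intro prod.cong refl) (auto simp: pair_gain_def power2_eq_square power3_eq_cube)
  also have "\<dots> = (real (k p0) + 1) * (\<Prod>p\<in>P - {p0}. if k p = 1 then 1 else gain)"
    using p0(1) finite_P by (simp add: prod.remove)
  also have "(\<Prod>p\<in>P - {p0}. if k p = 1 then 1 else gain) = (\<Prod>p\<in>?L - {p0}. gain)"
    using finite_P by (intro prod.mono_neutral_cong_right) auto
  also have "\<dots> = gain ^ (card ?L - 1)"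
    using p0 finite_P by simp
  finally have "(\<Prod>p\<in>P. pair_gain {p0} k p) * (\<Prod>p\<in>P. real (k p) + 1) ^ 3
      = (real (k p0) + 1) * gain ^ (card ?L - 1)" .
  moreover have pos: "0 < (\<Prod>p\<in>P. pair_gain {p0} k p)"
    by (intro prod_pos) (auto simp: pair_gain_def gain_def)
  moreover have "real (card S) * (\<Prod>p\<in>P. pair_gain {p0} k p) \<le> 6"
    using card_le_six_pair_bounds[OF p0(1)] pos by (simp add: field_simps)
  then have "real (card S) * (\<Prod>p\<in>P. pair_gain {p0} k p) * (\<Prod>p\<in>P. real (k p) + 1) ^ 3
      \<le> 6 * (\<Prod>p\<in>P. real (k p) + 1) ^ 3"
    by (intro mult_right_mono) (auto intro!: prod_nonneg)
  ultimately show ?thesis by (simp add: mult.assoc)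
qed

text \<open>
  The weight behind (a) loses a factor 6 at primes of exponent at least 2; with the mixing parameter 1/200
  this is absorbed by the gain there, as gain to the power 199 exceeds 6.
\<close>
definition simple_gain :: real where "simple_gain = (800 / 787) powr (1 / 200)"

lemma simple_gain_gt_1: "1 < simple_gain"
  unfolding simple_gain_def by (rule gr_one_powr) auto

lemma combined_gain:
  assumes "1 \<le> k p"
  shows "(if k p = 1 then simple_gain else 1)
    \<le> pair_gain {} k p powr (1 - 1 / 200) * quad_gain k p powr (1 / 200) * (real (k p) + 1) ^ 3"
proof (cases "k p = 1")
  case True
  have "(1 / 8 :: real) powr (1 - 1 / 200) * (100 / 787) powr (1 / 200) * 8
      = (1 / 8) powr (1 - 1 / 200) * (100 / 787) powr (1 / 200) * (8 powr (1 - 1 / 200) * 8 powr (1 / 200))"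
    by (simp flip: powr_add)
  also have "\<dots> = (1 / 8 * 8) powr (1 - 1 / 200) * (100 / 787 * 8) powr (1 / 200)"
    unfolding powr_mult by (simp only: mult_ac)
  also have "\<dots> = simple_gain"
    by (simp add: simple_gain_def)
  finally show ?thesis using True by (simp add: pair_gain_def quad_gain_def)
next
  case False
  define q where "q = (real (k p) + 1) ^ 3"
  have q: "q > 0" by (simp add: q_def)
  have "0 < gain" by (simp add: gain_def)
  have "6 \<le> gain ^ 199" by (simp add: gain_def power_divide)
  then have "1 \<le> (gain ^ 199 / 6) powr (1 / 200)" by (intro ge_one_powr_ge_zero) auto
  also have "\<dots> = gain powr (1 - 1 / 200) * (1 / 6) powr (1 / 200)"
    using powr_powr[of gain 199 "1 / 200"] \<open>0 < gain\<close> by (simp add: powr_divide)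
  also have "\<dots> = (gain / q * q) powr (1 - 1 / 200) * (1 / (6 * q) * q) powr (1 / 200)"
    using q by simp
  also have "\<dots> = (gain / q) powr (1 - 1 / 200) * (1 / (6 * q)) powr (1 / 200)
      * (q powr (1 - 1 / 200) * q powr (1 / 200))"
    unfolding powr_mult by (simp only: mult_ac)
  also have "q powr (1 - 1 / 200) * q powr (1 / 200) = q"
    using q by (simp flip: powr_add)
  finally show ?thesis using False by (simp add: pair_gain_def quad_gain_def q_def)
qed

text \<open>Mixing the weights of both kinds with parameter 1/200 saves a constant at every prime of
  exponent 1 and loses nothing elsewhere.\<close>

lemma (in tied_family) card_le_of_simple_exponents:
  assumes rigid: "\<And>s t. s \<in> S \<Longrightarrow> t \<in> S \<Longrightarrow>
      (\<And>p. p \<in> P \<Longrightarrow> x1 s p + x2 t p = x2 s p + x1 t p \<and> x3 s p + x4 t p = x4 s p + x3 t p) \<Longrightarrow>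
      (\<forall>p\<in>P. x1 s p + x3 t p = x3 s p + x1 t p)"
  shows "real (card S) * simple_gain ^ card {p\<in>P. k p = 1} \<le> (\<Prod>p\<in>P. real (k p) + 1) ^ 3"
proof -
  obtain W1 where W1: "sum W1 S \<le> 1" "\<And>s. s \<in> S \<Longrightarrow> (\<Prod>p\<in>P. pair_gain {} k p) \<le> W1 s" "\<And>s. 0 \<le> W1 s"
    using pair_weight_exists[of "{}"] by (metis empty_iff)
  obtain W2 where W2: "sum W2 S \<le> 1" "\<And>s. s \<in> S \<Longrightarrow> (\<Prod>p\<in>P. quad_gain k p) \<le> W2 s" "\<And>s. 0 \<le> W2 s"
    using quad_weight_exists[OF rigid] by blast
  define g where "g p = pair_gain {} k p powr (1 - 1 / 200) * quad_gain k p powr (1 / 200)" for p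
  have pos: "0 < pair_gain {} k p" "0 < quad_gain k p" for p
    by (auto simp: pair_gain_def quad_gain_def gain_def)
  have g_pos: "0 < g p" for p using pos[of p] by (simp add: g_def)
  have "real (card S) \<le> 1 / (\<Prod>p\<in>P. g p)"
  proof (rule card_le_of_weight)
    show "(\<Sum>s\<in>S. W1 s powr (1 - 1 / 200) * W2 s powr (1 / 200)) \<le> 1"
      by (intro sum_powr_mean_le_1 W1 W2) auto
    fix s assume "s \<in> S"
    have "(\<Prod>p\<in>P. g p) = (\<Prod>p\<in>P. pair_gain {} k p) powr (1 - 1 / 200) * (\<Prod>p\<in>P. quad_gain k p) powr (1 / 200)"
      unfolding g_def prod.distrib by (subst (1 2) prod_powr_distrib) (auto intro: less_imp_le pos)
    also have "\<dots> \<le> W1 s powr (1 - 1 / 200) * W2 s powr (1 / 200)"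
      using W1(2) W2(2) \<open>s \<in> S\<close> pos
      by (intro mult_mono powr_mono2 prod_nonneg) (auto intro: less_imp_le)
    finally show "(\<Prod>p\<in>P. g p) \<le> W1 s powr (1 - 1 / 200) * W2 s powr (1 / 200)" .
  qed (auto intro!: prod_pos g_pos)
  then have "real (card S) * (\<Prod>p\<in>P. g p) \<le> 1"
    using prod_pos[of P g] g_pos by (simp add: field_simps)
  then have *: "real (card S) * (\<Prod>p\<in>P. g p) * (\<Prod>p\<in>P. real (k p) + 1) ^ 3 \<le> 1 * (\<Prod>p\<in>P. real (k p) + 1) ^ 3"
    by (intro mult_right_mono) (auto intro!: prod_nonneg)
  have "simple_gain ^ card {p\<in>P. k p = 1} = (\<Prod>p\<in>{p\<in>P. k p = 1}. simple_gain)" by simp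
  also have "\<dots> = (\<Prod>p\<in>P. if k p = 1 then simple_gain else 1)"
    using finite_P by (intro prod.mono_neutral_cong_left) auto
  also have "\<dots> \<le> (\<Prod>p\<in>P. g p * (real (k p) + 1) ^ 3)"
    unfolding g_def
  proof (intro prod_mono conjI combined_gain k_pos)
    show "0 \<le> (if k p = 1 then simple_gain else 1)" for p
      using simple_gain_gt_1 by simp
  qed
  also have "\<dots> = (\<Prod>p\<in>P. g p) * (\<Prod>p\<in>P. real (k p) + 1) ^ 3"
    by (simp add: prod.distrib prod_power_distrib)
  finally have "real (card S) * simple_gain ^ card {p\<in>P. k p = 1}
      \<le> real (card S) * ((\<Prod>p\<in>P. g p) * (\<Prod>p\<in>P. real (k p) + 1) ^ 3)"
    by (intro mult_left_mono) auto
  then show ?thesis using * by (simp add: mult.assoc)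
qed

section \<open>The two bounds for the energy of the divisors\<close>

lemma additive_energy_eq: "additive_energy A = card (solutions A)"
  by (simp add: additive_energy_def solutions_def)

lemma additive_energy_squarefree_le:
  assumes n: "n \<ge> 1" and "squarefree n"
  shows "real (additive_energy (divisors n)) \<le> 7.8784716 ^ omega n"
proof -
  interpret tied_family "solutions (divisors n)" "prime_factors n" "\<lambda>p. multiplicity p n" mult1 mult2 mult3 mult4
    using n by (intro tied_family_solutions) simp
  obtain W where W: "sum W (solutions (divisors n)) \<le> 1"
    "\<And>s. s \<in> solutions (divisors n) \<Longrightarrow> (\<Prod>p\<in>prime_factors n. quad_gain (\<lambda>p. multiplicity p n) p) \<le> W s"
    by (rule quad_weight_exists[OF solutions_rigid]) (use n in auto)
  have "multiplicity p n = 1" if "p \<in> prime_factors n" for p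
    using that assms squarefree_factorial_semiring'[of n] by auto
  then have "(\<Prod>p\<in>prime_factors n. quad_gain (\<lambda>p. multiplicity p n) p) = (100 / 787) ^ omega n"
    by (simp add: quad_gain_def omega_def)
  then have "real (card (solutions (divisors n))) \<le> 1 / (100 / 787) ^ omega n"
    using W by (intro card_le_of_weight) auto
  also have "\<dots> = (787 / 100) ^ omega n" by (simp add: power_divide)
  also have "\<dots> \<le> 7.8784716 ^ omega n" by (intro power_mono) auto
  finally show ?thesis by (simp add: additive_energy_eq)
qed

text \<open>By Bernoulli's inequality; it trades a saving exponential in the number of primes for
  the square root in (b).\<close>

lemma of_nat_le_power_div:
  fixes r :: real
  assumes "1 < r"
  shows "real m \<le> r ^ m / (r - 1)"
  using Bernoulli_inequality[of "r - 1" m] assms by (simp add: field_simps)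

lemma sqrt_of_nat_le: "sqrt (real m) \<le> real m"
  by (rule real_le_lsqrt) (simp_all add: power2_eq_square flip: of_nat_mult)

lemma Omega2_le:
  assumes "\<And>p. p \<in> prime_factors n \<Longrightarrow> multiplicity p n \<le> K"
  shows "Omega2 n \<le> card {p\<in>prime_factors n. multiplicity p n = 1}
    + K\<^sup>2 * card {p\<in>prime_factors n. multiplicity p n \<noteq> 1}"
proof -
  let ?P = "prime_factors n"
  have "Omega2 n \<le> (\<Sum>p\<in>?P. of_bool (multiplicity p n = 1) + K\<^sup>2 * of_bool (multiplicity p n \<noteq> 1))"
    unfolding Omega2_def by (intro sum_mono) (use assms in \<open>auto intro: power_mono\<close>)
  also have "\<dots> = card {p\<in>?P. multiplicity p n = 1} + K\<^sup>2 * card {p\<in>?P. multiplicity p n \<noteq> 1}"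
    by (simp add: sum.distrib Int_def flip: sum_distrib_left)
  finally show ?thesis .
qed

text \<open>With \<open>a\<close> primes of exponent 1, \<open>L\<close> others and largest exponent
  \<open>K\<close>, sqrt \<open>Omega2\<close> is at most sqrt \<open>a\<close> + \<open>K\<close>
  sqrt \<open>L\<close>. The savings at exponent 1 pay for the first term, those at the other primes
  for the second.\<close>

lemma additive_energy_sqrt_Omega2_le:
  assumes n: "n \<ge> 1"
  shows "real (additive_energy (divisors n)) * sqrt (real (Omega2 n))
    \<le> (1 / (simple_gain - 1) + 606) * real (tau n) ^ 3"
proof -
  let ?P = "prime_factors n" and ?k = "\<lambda>p. multiplicity p n"
  define E where "E = real (card (solutions (divisors n)))"
  define T where "T = real (tau n)"
  define a where "a = card {p\<in>?P. ?k p = 1}"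
  define L where "L = card {p\<in>?P. ?k p \<noteq> 1}"
  \<comment> \<open>The 0 keeps \<open>Max\<close> defined when \<open>n\<close> has no prime
    factor.\<close>
  define K where "K = Max (insert 0 (?k ` ?P))"
  interpret tied_family "solutions (divisors n)" ?P ?k mult1 mult2 mult3 mult4
    using n by (intro tied_family_solutions) simp
  have T: "(\<Prod>p\<in>?P. real (?k p) + 1) \<le> T"
    using of_nat_mono[OF prod_multiplicity_le_tau[of n], where 'a=real] n
    by (simp add: T_def add.commute[of 1])
  then have T3: "(\<Prod>p\<in>?P. real (?k p) + 1) ^ 3 \<le> T ^ 3"
    by (intro power_mono) (auto intro!: prod_nonneg)
  have small: "E * sqrt a \<le> 1 / (simple_gain - 1) * T ^ 3"
  proof -
    have "E * sqrt a \<le> E * (simple_gain ^ a / (simple_gain - 1))"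
      by (intro mult_left_mono order_trans[OF sqrt_of_nat_le of_nat_le_power_div] simple_gain_gt_1)
        (simp add: E_def)
    also have "\<dots> = E * simple_gain ^ a / (simple_gain - 1)" by simp
    also have "\<dots> \<le> T ^ 3 / (simple_gain - 1)"
    proof (rule divide_right_mono)
      have "E * simple_gain ^ a \<le> (\<Prod>p\<in>?P. real (?k p) + 1) ^ 3"
        unfolding E_def a_def
        by (rule card_le_of_simple_exponents[OF solutions_rigid]) (use n in simp_all)
      with T3 show "E * simple_gain ^ a \<le> T ^ 3" by linarith
    qed (use simple_gain_gt_1 in simp)
    finally show ?thesis by simp
  qed
  have large: "E * (K * sqrt L) \<le> 606 * T ^ 3"
  proof (cases "L = 0")
    case True
    then show ?thesis by (simp add: T_def)
  next
    case False
    then obtain p1 where p1: "p1 \<in> ?P" "?k p1 \<noteq> 1" by (auto simp: L_def card_eq_0_iff)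
    have "K \<in> insert 0 (?k ` ?P)" unfolding K_def by (rule Max_in) auto
    moreover have "?k p1 \<le> K" unfolding K_def using p1 by (intro Max_ge) auto
    moreover have "1 < ?k p1" using k_pos[OF p1(1)] p1(2) by simp
    ultimately obtain p0 where p0: "p0 \<in> ?P" "K = ?k p0" "?k p0 \<noteq> 1" by auto
    have "sqrt L \<le> gain ^ L / (gain - 1)"
      by (rule order_trans[OF sqrt_of_nat_le of_nat_le_power_div]) (simp add: gain_def)
    \<comment> \<open>101 is \<open>gain\<close> / (\<open>gain\<close> - 1); with the six pairs it
      gives the constant 606.\<close>
    also have "\<dots> = 101 * gain ^ (L - 1)"
      using False by (cases L) (auto simp: gain_def)
    finally have "E * (K * sqrt L) \<le> E * ((real K + 1) * (101 * gain ^ (L - 1)))"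
      by (intro mult_left_mono mult_mono) (auto simp: E_def)
    also have "\<dots> = 101 * (E * (real K + 1) * gain ^ (L - 1))" by simp
    also have "\<dots> \<le> 101 * (6 * T ^ 3)"
      using card_le_of_large_exponent[OF p0(1,3)] T3 by (simp add: E_def L_def p0(2))
    finally show ?thesis by simp
  qed
  have "Omega2 n \<le> a + K\<^sup>2 * L"
    unfolding a_def L_def by (rule Omega2_le) (auto simp: K_def)
  then have "sqrt (real (Omega2 n)) \<le> sqrt (real a + real K ^ 2 * real L)"
    by (intro real_sqrt_le_mono) (simp flip: of_nat_add of_nat_mult of_nat_power)
  also have "\<dots> \<le> sqrt a + K * sqrt L"
    using sqrt_add_le_add_sqrt[of "real a" "real K ^ 2 * real L"] by (simp add: real_sqrt_mult)
  finally have "E * sqrt (real (Omega2 n)) \<le> E * (sqrt a + K * sqrt L)"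
    by (intro mult_left_mono) (auto simp: E_def)
  also have "\<dots> \<le> (1 / (simple_gain - 1) + 606) * T ^ 3"
    using small large by (simp add: algebra_simps)
  finally show ?thesis by (simp add: E_def T_def additive_energy_eq)
qed

text \<open>Allows division by the square root, which vanishes at n = 1.\<close>

lemma Omega2_pos:
  assumes "n \<ge> 2"
  shows "Omega2 n > 0"
proof -
  obtain p where "prime p" "p dvd n" using assms prime_factor_nat[of n] by auto
  then have p: "p \<in> prime_factors n" using assms by (simp add: prime_factors_dvd)
  then have "0 < (multiplicity p n)\<^sup>2" by (simp add: prime_factors_multiplicity)
  also have "\<dots> \<le> Omega2 n" unfolding Omega2_def using p by (intro member_le_sum) auto
  finally show ?thesis .
qed

theorem theorem3:
  "(\<exists>C::real. C > 0 \<and> (\<forall>n::nat. n \<ge> 1 \<and> squarefree n \<longrightarrow>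
      real (additive_energy (divisors n)) \<le> C * 7.8784716 ^ omega n)) \<and>
   (\<exists>C::real. C > 0 \<and> (\<forall>n::nat. n \<ge> 2 \<longrightarrow>
      real (additive_energy (divisors n)) \<le> C * (real (tau n) ^ 3 / sqrt (real (Omega2 n)))))"
proof
  show "\<exists>C::real. C > 0 \<and> (\<forall>n::nat. n \<ge> 1 \<and> squarefree n \<longrightarrow>
      real (additive_energy (divisors n)) \<le> C * 7.8784716 ^ omega n)"
    using additive_energy_squarefree_le by (intro exI[of _ 1]) auto
  have "real (additive_energy (divisors n))
      \<le> (1 / (simple_gain - 1) + 606) * (real (tau n) ^ 3 / sqrt (real (Omega2 n)))" if "n \<ge> 2" for n
    using additive_energy_sqrt_Omega2_le[of n] Omega2_pos[OF that] that by (simp add: field_simps)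
  moreover have "1 / (simple_gain - 1) + 606 > 0"
    using simple_gain_gt_1 by (simp add: add_pos_pos)
  ultimately show "\<exists>C::real. C > 0 \<and> (\<forall>n::nat. n \<ge> 2 \<longrightarrow>
      real (additive_energy (divisors n)) \<le> C * (real (tau n) ^ 3 / sqrt (real (Omega2 n))))"
    by blast
qed

end
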